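(* Let $A$ be any positive real number, and for a prime $q$ put $\sigma_A := 1 - A/\log\log q$. Then there is a constant $C>0$ (depending only on $A$) such that for all sufficiently large primes $q$, $$\max_{\substack{\chi \neq \chi_0 \\ \chi \,(\mathrm{mod}\ q)}} \left(-\operatorname{Re}\frac{L'}{L}(\sigma_A,\chi)\right) \geqslant \frac{e^{A}-1}{A}\log\log q - C\,\frac{\log\log q}{\log\log\log q},$$ where the maximum is over all non-principal Dirichlet characters $\chi$ modulo $q$. In particular, for all sufficiently large primes $q$, $$\max_{\substack{\chi \neq \chi_0 \\ \chi \,(\mathrm{mod}\ q)}} \left|\frac{L'}{L}(\sigma_A,\chi)\right| \geqslant \frac{e^{A}-1}{A}\log\log q - C\,\frac{\log\log q}{\log\log\log q}.$$
   Context: $L(s,\chi)$ is the Dirichlet $L$-function of the Dirichlet character $\chi$, and $\chi_0$ denotes the principal character modulo $q$. The paper writes the error term as $O(\log_2 q/\log_3 q)$. *)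

theory Defs
  imports "HOL-Complex_Analysis.Complex_Analysis" "HOL-Number_Theory.Number_Theory"
begin

section \<open>Dirichlet characters\<close>

definition dirichlet_character :: "nat \<Rightarrow> (nat \<Rightarrow> complex) \<Rightarrow> bool" where
  "dirichlet_character q \<psi> \<longleftrightarrow>
     \<psi> 1 = 1 \<and>
     (\<forall>a b. \<psi> (a * b) = \<psi> a * \<psi> b) \<and>
     (\<forall>a. \<psi> (a + q) = \<psi> a) \<and>
     (\<forall>a. \<psi> a = 0 \<longleftrightarrow> \<not> coprime a q)"

definition principal_character :: "nat \<Rightarrow> nat \<Rightarrow> complex" where
  "principal_character q = (\<lambda>a. if coprime a q then 1 else 0)"

definition nonprincipal_characters :: "nat \<Rightarrow> (nat \<Rightarrow> complex) set" where
  "nonprincipal_characters q = {\<psi>. dirichlet_character q \<psi> \<and> \<psi> \<noteq> principal_character q}"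

section \<open>Dirichlet L-functions\<close>

text \<open>
  For a non-principal character the Dirichlet series converges (conditionally) on the whole
  half-plane \<open>Re s > 0\<close> and is holomorphic there, so on that half-plane it is the analytic
  continuation of the series from its half-plane \<open>Re s > 1\<close> of absolute convergence; both facts
  are proved below as \<open>dirichlet_L_sums\<close> and \<open>dirichlet_L_holomorphic\<close>. The definition is not
  meaningful outside that half-plane, nor for the principal character when \<open>Re s \<le> 1\<close>.
\<close>

definition dirichlet_L :: "(nat \<Rightarrow> complex) \<Rightarrow> complex \<Rightarrow> complex" where
  "dirichlet_L \<psi> s = (\<Sum>n. \<psi> (Suc n) / of_nat (Suc n) powr s)"

text \<open>At a zero of the L-function the value is \<open>0\<close>, by the convention \<open>x / 0 = 0\<close>.\<close>

definition log_deriv_L :: "(nat \<Rightarrow> complex) \<Rightarrow> complex \<Rightarrow> complex" where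
  "log_deriv_L \<psi> s = deriv (dirichlet_L \<psi>) s / dirichlet_L \<psi> s"

definition sigma_A :: "real \<Rightarrow> nat \<Rightarrow> real" where
  "sigma_A A q = 1 - A / ln (ln (real q))"

section \<open>Basic properties of characters\<close>

lemma dirichlet_character_mod:
  assumes "dirichlet_character q \<psi>"
  shows "\<psi> (n mod q) = \<psi> n"
proof -
  have "\<psi> (m + k * q) = \<psi> m" for m k
  proof (induction k)
    case (Suc k)
    have "\<psi> (m + Suc k * q) = \<psi> ((m + k * q) + q)" by (simp add: algebra_simps)
    also have "\<dots> = \<psi> (m + k * q)" using assms unfolding dirichlet_character_def by blast
    finally show ?case using Suc by simp
  qed simp
  from this[of "n mod q" "n div q"] show ?thesis by (simp add: mod_div_mult_eq)
qed

lemma dirichlet_character_power: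
  assumes "dirichlet_character q \<psi>"
  shows "\<psi> (a ^ k) = \<psi> a ^ k"
  using assms unfolding dirichlet_character_def by (induction k) auto

lemma dirichlet_character_root_of_unity:
  assumes "dirichlet_character q \<psi>" "coprime a q"
  shows "\<psi> a ^ totient q = 1"
proof -
  have "[a ^ totient q = 1] (mod q)" using assms(2) by (rule euler_theorem)
  hence "\<psi> (a ^ totient q) = \<psi> 1"
    using dirichlet_character_mod[OF assms(1)] unfolding cong_def by metis
  thus ?thesis
    using assms(1) dirichlet_character_power[OF assms(1)] unfolding dirichlet_character_def by simp
qed

lemma finite_dirichlet_characters:
  assumes "q > 0"
  shows "finite {\<psi>. dirichlet_character q \<psi>}"
proof -
  let ?R = "insert 0 {z::complex. z ^ totient q = 1}"
  have "finite ?R" using assms by (auto intro!: finite_roots_unity simp: Suc_le_eq)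
  hence fin: "finite (PiE {..<q} (\<lambda>_. ?R))" by (intro finite_PiE) auto
  have "(\<lambda>\<psi>. restrict \<psi> {..<q}) ` {\<psi>. dirichlet_character q \<psi>} \<subseteq> PiE {..<q} (\<lambda>_. ?R)"
  proof (intro image_subsetI PiE_I)
    fix \<psi> n assume *: "\<psi> \<in> {\<psi>. dirichlet_character q \<psi>}" "n \<in> {..<q}"
    show "restrict \<psi> {..<q} n \<in> ?R"
      using * dirichlet_character_root_of_unity[of q \<psi> n] by (auto simp: dirichlet_character_def)
  qed auto
  moreover have "inj_on (\<lambda>\<psi>. restrict \<psi> {..<q}) {\<psi>. dirichlet_character q \<psi>}"
  proof (rule inj_onI, clarify)
    fix \<psi> \<phi> assume *: "dirichlet_character q \<psi>" "dirichlet_character q \<phi>"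
      "restrict \<psi> {..<q} = restrict \<phi> {..<q}"
    show "\<psi> = \<phi>"
    proof
      fix n
      have "\<psi> (n mod q) = \<phi> (n mod q)"
        using fun_cong[OF *(3), of "n mod q"] assms by simp
      thus "\<psi> n = \<phi> n" using *(1,2) by (simp add: dirichlet_character_mod)
    qed
  qed
  ultimately show ?thesis using fin by (meson finite_subset finite_imageD)
qed

lemma finite_nonprincipal_characters: "q > 0 \<Longrightarrow> finite (nonprincipal_characters q)"
  using finite_dirichlet_characters by (auto simp: nonprincipal_characters_def)

lemma sum_nonprincipal_character:
  assumes "\<psi> \<in> nonprincipal_characters q" "q > 0"
  shows "(\<Sum>n<q. \<psi> n) = 0"
proof -
  have chi: "dirichlet_character q \<psi>" using assms(1) by (simp add: nonprincipal_characters_def)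
  obtain a where a: "\<psi> a \<noteq> principal_character q a"
    using assms(1) by (auto simp: nonprincipal_characters_def)
  have cop: "coprime a q" and ne: "\<psi> a \<noteq> 1"
    using a chi by (auto simp: principal_character_def dirichlet_character_def split: if_splits)
  have inj: "inj_on (\<lambda>n. (a * n) mod q) {..<q}"
  proof (rule inj_onI)
    fix x y assume *: "x \<in> {..<q}" "y \<in> {..<q}" "(a * x) mod q = (a * y) mod q"
    hence "[x = y] (mod q)"
      using cop by (simp add: cong_def[symmetric] cong_mult_lcancel_nat)
    thus "x = y" using * by (simp add: cong_def)
  qed
  moreover have "(\<lambda>n. (a * n) mod q) ` {..<q} \<subseteq> {..<q}" using assms(2) by auto
  ultimately have "bij_betw (\<lambda>n. (a * n) mod q) {..<q} {..<q}"
    by (simp add: bij_betw_def endo_inj_surj)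
  hence "(\<Sum>n<q. \<psi> n) = (\<Sum>n<q. \<psi> ((a * n) mod q))"
    by (rule sum.reindex_bij_betw[symmetric])
  also have "\<dots> = \<psi> a * (\<Sum>n<q. \<psi> n)"
    using chi unfolding dirichlet_character_mod[OF chi]
    by (simp add: dirichlet_character_def sum_distrib_left)
  finally show ?thesis using ne by simp
qed

lemma bounded_partial_sums_nonprincipal_character:
  assumes "\<psi> \<in> nonprincipal_characters q" "q > 0"
  shows "\<exists>B>0. \<forall>n. norm (\<Sum>k<n. \<psi> (Suc k)) \<le> B"
proof -
  have chi: "dirichlet_character q \<psi>" using assms(1) by (simp add: nonprincipal_characters_def)
  define B where "B = 1 + (\<Sum>k<q. norm (\<psi> k)) + norm (\<psi> 0)"
  have per: "(\<Sum>k<n + m * q. \<psi> k) = (\<Sum>k<n. \<psi> k)" for n m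
  proof (induction m)
    case (Suc m)
    have shift: "(\<Sum>k<N + q. \<psi> k) = (\<Sum>k<N. \<psi> k)" for N
    proof (induction N)
      case 0
      show ?case using sum_nonprincipal_character[OF assms] by simp
    next
      case (Suc N)
      have "\<psi> (N + q) = \<psi> N" using chi unfolding dirichlet_character_def by blast
      thus ?case using Suc by simp
    qed
    have "n + Suc m * q = (n + m * q) + q" by (simp add: algebra_simps)
    thus ?case using shift Suc by metis
  qed simp
  have bd: "norm (\<Sum>k<n. \<psi> k) \<le> (\<Sum>k<q. norm (\<psi> k))" for n
  proof -
    have "(\<Sum>k<n. \<psi> k) = (\<Sum>k<n mod q. \<psi> k)"
      using per[of "n mod q" "n div q"] by (simp add: mod_div_mult_eq)
    also have "norm \<dots> \<le> (\<Sum>k<n mod q. norm (\<psi> k))" by (rule norm_sum)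
    also have "\<dots> \<le> (\<Sum>k<q. norm (\<psi> k))"
      using assms(2) by (intro sum_mono2) (auto intro: order.strict_trans)
    finally show ?thesis .
  qed
  have "norm (\<Sum>k<n. \<psi> (Suc k)) \<le> B" for n
  proof -
    have "(\<Sum>k<n. \<psi> (Suc k)) = (\<Sum>k<Suc n. \<psi> k) - \<psi> 0"
      by (simp only: sum.lessThan_Suc_shift) simp
    also have "norm \<dots> \<le> norm (\<Sum>k<Suc n. \<psi> k) + norm (\<psi> 0)" by (rule norm_triangle_ineq4)
    finally show ?thesis using bd[of "Suc n"] unfolding B_def by linarith
  qed
  moreover have "B > 0" unfolding B_def by (intro add_pos_nonneg sum_nonneg) auto
  ultimately show ?thesis by blast
qed

section \<open>Convergence and holomorphy for positive real part\<close>

lemma norm_powr_Suc: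
  "norm (complex_of_nat (Suc k) powr s) = real (Suc k) powr Re s"
  using norm_powr_real_powr[of "of_nat (Suc k)" s] by (simp del: of_nat_Suc)

lemma norm_powr_diff_le:
  assumes "Re s > 0"
  shows "norm (complex_of_nat (Suc k) powr (-s) - of_nat (Suc (Suc k)) powr (-s))
           \<le> norm s * real (Suc k) powr (- Re s - 1)"
proof -
  let ?S = "closed_segment (complex_of_nat (Suc k)) (of_nat (Suc (Suc k)))"
  have S: "Im z = 0 \<and> real (Suc k) \<le> Re z" if "z \<in> ?S" for z
  proof -
    have "z \<in> closed_segment (complex_of_real (real (Suc k))) (of_real (real (Suc (Suc k))))"
      using that by simp
    thus ?thesis unfolding closed_segment_of_real by (auto simp: closed_segment_eq_real_ivl)
  qed
  have "norm (complex_of_nat (Suc k) powr (-s) - of_nat (Suc (Suc k)) powr (-s))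
     \<le> (norm s * real (Suc k) powr (- Re s - 1))
         * norm (complex_of_nat (Suc k) - of_nat (Suc (Suc k)))"
  proof (rule field_differentiable_bound[where S = ?S and f' = "\<lambda>z. -s * z powr (-s - 1)"])
    fix z assume z: "z \<in> ?S"
    have "z \<notin> \<real>\<^sub>\<le>\<^sub>0" using S[OF z] by (auto simp: complex_nonpos_Reals_iff)
    thus "((\<lambda>z. z powr (-s)) has_field_derivative -s * z powr (-s - 1)) (at z within ?S)"
      by (rule has_field_derivative_at_within[OF has_field_derivative_powr])
    have "norm (z powr (-s - 1)) = Re z powr (- Re s - 1)"
      using S[OF z] norm_powr_real_powr[of z "-s - 1"] by (auto simp: complex_is_Real_iff)
    also have "\<dots> \<le> real (Suc k) powr (- Re s - 1)"
      using S[OF z] assms by (intro powr_mono2') auto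
    finally show "norm (-s * z powr (-s - 1)) \<le> norm s * real (Suc k) powr (- Re s - 1)"
      by (simp add: norm_mult mult_left_mono)
  qed auto
  thus ?thesis by (simp add: norm_minus_commute)
qed

locale bounded_partial_sums =
  fixes f :: "nat \<Rightarrow> complex" and B :: real
  assumes B: "\<And>n. norm (\<Sum>k<n. f k) \<le> B"
begin

definition T :: "nat \<Rightarrow> complex \<Rightarrow> complex" where
  "T k s = (\<Sum>j<Suc k. f j) * (of_nat (Suc k) powr (-s) - of_nat (Suc (Suc k)) powr (-s))"

lemma B_nonneg: "B \<ge> 0"
  using B[of 0] by simp

lemma norm_T_le:
  assumes "\<sigma> > 0" "Re s \<ge> \<sigma>" "norm s \<le> R"
  shows "norm (T k s) \<le> B * (R * real (Suc k) powr (- \<sigma> - 1))"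
proof -
  have "R \<ge> 0" using assms(3) norm_ge_zero[of s] by linarith
  hence "norm s * real (Suc k) powr (- Re s - 1) \<le> R * real (Suc k) powr (- \<sigma> - 1)"
    using assms by (intro mult_mono powr_mono) auto
  with norm_powr_diff_le[of s k] assms
  have "norm (complex_of_nat (Suc k) powr (-s) - of_nat (Suc (Suc k)) powr (-s))
          \<le> R * real (Suc k) powr (- \<sigma> - 1)" by linarith
  thus ?thesis unfolding T_def norm_mult using B_nonneg by (intro mult_mono B) auto
qed

lemma summable_bound:
  assumes "\<sigma> > 0"
  shows "summable (\<lambda>k. B * (R * real (Suc k) powr (- \<sigma> - 1)))"
proof -
  have "summable (\<lambda>k. real k powr (- \<sigma> - 1))" using assms by (simp add: summable_real_powr_iff)
  hence "summable (\<lambda>k. real (Suc k) powr (- \<sigma> - 1))" by (subst summable_Suc_iff)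
  thus ?thesis by (intro summable_mult)
qed

lemma abel_summation:
  "(\<Sum>k<n. f k / of_nat (Suc k) powr s) =
     (\<Sum>k<n. f k) * of_nat (Suc n) powr (-s) + (\<Sum>k<n. T k s)"
  by (induction n) (simp_all add: T_def powr_minus_divide algebra_simps
        add_divide_distrib del: of_nat_Suc)

lemma series_sums:
  assumes "Re s > 0"
  shows "(\<lambda>k. f k / of_nat (Suc k) powr s) sums (\<Sum>k. T k s)"
proof -
  have "summable (\<lambda>k. T k s)"
    by (rule summable_comparison_test'[OF summable_bound[OF assms] norm_T_le[OF assms]]) auto
  hence lim1: "(\<lambda>n. \<Sum>k<n. T k s) \<longlonglongrightarrow> (\<Sum>k. T k s)" by (rule summable_LIMSEQ)
  have "(\<lambda>n. real (Suc n) powr (- Re s)) \<longlonglongrightarrow> 0"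
    using assms by (intro tendsto_neg_powr filterlim_compose[OF filterlim_real_sequentially]
                      filterlim_Suc) auto
  hence "(\<lambda>n. B * real (Suc n) powr (- Re s)) \<longlonglongrightarrow> 0" by (rule tendsto_mult_right_zero)
  hence lim0: "(\<lambda>n. (\<Sum>k<n. f k) * of_nat (Suc n) powr (-s)) \<longlonglongrightarrow> 0"
  proof (rule Lim_null_comparison[rotated], intro always_eventually allI)
    fix n
    show "norm ((\<Sum>k<n. f k) * of_nat (Suc n) powr (-s)) \<le> B * real (Suc n) powr (- Re s)"
      using mult_right_mono[OF B, of "real (Suc n) powr (- Re s)" n]
      by (simp add: norm_mult norm_powr_Suc del: of_nat_Suc)
  qed
  show ?thesis unfolding sums_def abel_summation using tendsto_add[OF lim0 lim1] by simp
qed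

lemma holomorphic_T: "(\<lambda>s. \<Sum>k. T k s) holomorphic_on {s. Re s > 0}"
proof (rule holomorphic_uniform_sequence[where f = "\<lambda>n s. \<Sum>k<n. T k s"])
  show "open {s. Re s > 0}" by (rule open_halfspace_Re_gt)
  show "(\<lambda>s. \<Sum>k<n. T k s) holomorphic_on {s. Re s > 0}" for n
    unfolding T_def by (intro holomorphic_intros) (auto simp del: of_nat_Suc)
  fix x assume x: "x \<in> {s. Re s > 0}"
  define d where "d = Re x / 2"
  have d: "d > 0" using x by (simp add: d_def)
  have cb: "Re s \<ge> d \<and> norm s \<le> norm x + d" if "s \<in> cball x d" for s
  proof -
    have "norm (x - s) \<le> d" using that by (simp add: dist_norm)
    moreover have "Re (x - s) \<le> norm (x - s)" by (rule complex_Re_le_cmod)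
    moreover have "norm s \<le> norm x + norm (x - s)"
      using norm_triangle_ineq4[of x "x - s"] by simp
    ultimately show ?thesis by (simp add: d_def)
  qed
  have "uniform_limit (cball x d) (\<lambda>n s. \<Sum>k<n. T k s) (\<lambda>s. \<Sum>k. T k s) sequentially"
    using norm_T_le[OF d] cb by (intro Weierstrass_m_test[OF _ summable_bound[OF d]]) blast
  moreover have "cball x d \<subseteq> {s. Re s > 0}" using cb d by force
  ultimately show "\<exists>d>0. cball x d \<subseteq> {s. Re s > 0} \<and>
      uniform_limit (cball x d) (\<lambda>n s. \<Sum>k<n. T k s) (\<lambda>s. \<Sum>k. T k s) sequentially"
    using d by blast
qed

end

lemma dirichlet_L_sums:
  assumes "\<psi> \<in> nonprincipal_characters q" "q > 0" "Re s > 0"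
  shows "(\<lambda>n. \<psi> (Suc n) / of_nat (Suc n) powr s) sums dirichlet_L \<psi> s"
proof -
  obtain B where "\<forall>n. norm (\<Sum>k<n. \<psi> (Suc k)) \<le> B"
    using bounded_partial_sums_nonprincipal_character[OF assms(1,2)] by blast
  then interpret bounded_partial_sums "\<lambda>k. \<psi> (Suc k)" B by unfold_locales auto
  show ?thesis unfolding dirichlet_L_def using series_sums[OF assms(3)] by (simp only: sums_iff)
qed

lemma dirichlet_L_holomorphic:
  assumes "\<psi> \<in> nonprincipal_characters q" "q > 0"
  shows "dirichlet_L \<psi> holomorphic_on {s. Re s > 0}"
proof -
  obtain B where "\<forall>n. norm (\<Sum>k<n. \<psi> (Suc k)) \<le> B"
    using bounded_partial_sums_nonprincipal_character[OF assms] by blast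
  then interpret bounded_partial_sums "\<lambda>k. \<psi> (Suc k)" B by unfold_locales auto
  have "dirichlet_L \<psi> s = (\<Sum>k. T k s)" if "Re s > 0" for s
    unfolding dirichlet_L_def using series_sums[OF that] by (simp only: sums_iff)
  thus ?thesis using holomorphic_T holomorphic_cong[of "{s. Re s > 0}" "{s. Re s > 0}"
      "dirichlet_L \<psi>" "\<lambda>s. \<Sum>k. T k s"] by auto
qed

end

theory Submission
  imports Defs "HOL-Real_Asymp.Real_Asymp"
begin

text \<open>
  A positivity argument with an infinite resonator. Let \<open>R(\<chi>)\<close> be the product of the Euler factors
  \<open>1 / (1 - lam \<chi>(p))\<close> over the primes \<open>p \<le> Y\<close>, where \<open>lam\<close> is slightly smaller than \<open>1\<close> and \<open>Y\<close>
  slightly smaller than \<open>log q\<close>. If \<open>- Re (L'/L)(\<sigma>, \<chi>) \<le> V\<close> for all \<open>\<chi> \<noteq> \<chi>\<^sub>0\<close>, multiply by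
  \<open>\<bar>R(\<chi>) L(\<sigma>, \<chi>)\<bar>\<^sup>2\<close> and sum over \<open>\<chi>\<close>; possible zeros of \<open>L\<close> disappear with this weight. Functions of
  \<open>\<chi>\<close> that are combinations of the values \<open>\<chi>(n)\<close> with nonnegative coefficients form a cone which is
  closed under products and conjugation, and by orthogonality each of them has a nonnegative sum
  over \<open>\<chi>\<close>. The cone contains \<open>R\<close>, \<open>L\<close> and, up to a multiple of the principal character,
  \<open>- L' - P L\<close>, where \<open>P(\<chi>)\<close> is the sum of \<open>\<Lambda>(d) \<chi>(d) d\<close> to the power \<open>- \<sigma>\<close> over \<open>d \<le> Y\<close>. It also
  contains the product of the conjugate of \<open>R\<close> with \<open>\<chi>(p\<^sup>k) - lam\<^sup>k\<close>. Hence \<open>V\<close> is at least about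
  \<open>P(\<chi>\<^sub>0)\<close>, which Mertens' theorem evaluates. The term of \<open>\<chi>\<^sub>0\<close> is negligible since
  \<open>R(\<chi>\<^sub>0)\<close> is smaller than any power of \<open>q\<close>.
\<close>

section \<open>Mertens' first theorem\<close>

text \<open>Induction on \<open>n\<close>: \<open>n div d\<close> grows by one exactly when
  \<open>d\<close> divides the new number, and \<open>mangoldt\<close> summed over the divisors of
  that number gives its logarithm.\<close>

lemma ln_fact_eq_sum_mangoldt:
  "ln (fact n :: real) = (\<Sum>d=1..n. mangoldt d * real (n div d))"
proof (induction n)
  case (Suc n)
  have "(\<Sum>d=1..Suc n. mangoldt d * real (Suc n div d))
      = (\<Sum>d=1..Suc n. mangoldt d * real (n div d) + (if d dvd Suc n then mangoldt d else 0))"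
    by (intro sum.cong) (auto simp: div_Suc algebra_simps dvd_eq_mod_eq_0)
  also have "\<dots> = (\<Sum>d=1..n. mangoldt d * real (n div d)) + (\<Sum>d | d dvd Suc n. mangoldt d)"
    unfolding sum.distrib
    by (intro arg_cong2[of _ _ _ _ "(+)"] sum.mono_neutral_cong_right)
       (auto simp: dvd_imp_le Suc_le_eq intro!: Nat.gr0I)
  also have "\<dots> = ln (fact (Suc n))"
    using Suc mangoldt_sum[of "Suc n", where ?'a = real] by (simp add: ln_mult del: of_nat_Suc)
  finally show ?case by simp
qed simp

lemma ln_fact_le: "ln (fact n :: real) \<le> real n * ln (real n)"
proof -
  have "ln (fact n :: real) \<le> ln (real n ^ n)"
    using fact_le_power[of n, where ?'a = real] by (simp add: ln_mono)
  thus ?thesis by (cases "n = 0") (auto simp: ln_realpow)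
qed

text \<open>\<open>n ^ n / fact n\<close> is a single term of the series of
  \<open>exp n\<close>.\<close>

lemma ln_fact_ge: "ln (fact n :: real) \<ge> real n * ln (real n) - real n"
proof (cases "n = 0")
  case False
  have "real n ^ n / fact n \<le> exp (real n)"
    using sum_le_suminf[OF summable_exp, of "{n}" "real n"]
    by (simp add: exp_def divide_inverse mult.commute scaleR_conv_of_real)
  hence "ln (real n ^ n / fact n) \<le> real n"
    using False by (subst ln_exp[symmetric], subst ln_le_cancel_iff) auto
  thus ?thesis using False by (simp add: ln_div ln_realpow)
qed simp

section \<open>Chebyshev's upper bound by halving\<close>

definition chebyshev_psi :: "nat \<Rightarrow> real" where
  "chebyshev_psi n = (\<Sum>d=1..n. mangoldt d)"

text \<open>The difference \<open>n div d - 2 * (n div 2 div d)\<close> is never negative and is at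
  least 1 for \<open>d\<close> above \<open>n div 2\<close> and up to \<open>n\<close>, so it
  majorises the indicator of that range.\<close>

lemma chebyshev_psi_halve:
  "chebyshev_psi n - chebyshev_psi (n div 2) \<le> ln (fact n) - 2 * ln (fact (n div 2))"
proof -
  let ?m = "n div 2"
  have 1: "ln (fact ?m :: real) = (\<Sum>d=1..n. mangoldt d * real (?m div d))"
    unfolding ln_fact_eq_sum_mangoldt by (intro sum.mono_neutral_left) auto
  have 2: "chebyshev_psi n - chebyshev_psi ?m
             = (\<Sum>d=1..n. mangoldt d * (if ?m < d then 1 else 0))"
  proof -
    have "chebyshev_psi ?m = (\<Sum>d=1..n. mangoldt d * (if ?m < d then 0 else 1))"
      unfolding chebyshev_psi_def by (intro sum.mono_neutral_cong_left) auto
    thus ?thesis unfolding chebyshev_psi_def sum_subtractf[symmetric]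
      by (simp add: sum_subtractf[symmetric]) (intro sum.cong, auto)
  qed
  have 3: "(if ?m < d then 1 else 0) \<le> real (n div d) - 2 * real (?m div d)"
    if "d \<in> {1..n}" for d
  proof -
    have "2 * (?m div d) \<le> n div d"
      using div_mult2_eq[of n d 2] div_mult2_eq[of n 2 d] by (simp add: mult.commute)
    moreover have "n div d \<ge> 1" using that by (simp add: div_greater_zero_iff Suc_le_eq)
    ultimately show ?thesis by auto
  qed
  have "chebyshev_psi n - chebyshev_psi ?m
      \<le> (\<Sum>d=1..n. mangoldt d * (real (n div d) - 2 * real (?m div d)))"
    unfolding 2 by (intro sum_mono mult_left_mono 3 mangoldt_nonneg)
  also have "\<dots> = ln (fact n) - 2 * ln (fact ?m)"
    unfolding 1 unfolding ln_fact_eq_sum_mangoldt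
    by (simp add: algebra_simps sum_subtractf sum_distrib_left)
  finally show ?thesis .
qed

text \<open>With \<open>m = n div 2\<close>, the central binomial coefficient is at most
  \<open>4 ^ m\<close>; the factor \<open>n\<close> that odd \<open>n\<close> leaves over costs only
  \<open>ln n\<close>.\<close>

lemma ln_fact_halve_le:
  assumes "n > 0"
  shows "ln (fact n :: real) - 2 * ln (fact (n div 2)) \<le> 2 * real n"
proof -
  define m where "m = n div 2"
  have "fact n \<le> real n * (4 ^ m * (fact m * fact m))"
  proof -
    have c: "fact (2 * m) \<le> (4::real) ^ m * (fact m * fact m)"
    proof -
      have "real ((2 * m) choose m) \<le> 2 ^ (2 * m)"
        using binomial_le_pow2[of "2 * m" m] by (metis of_nat_le_iff of_nat_numeral of_nat_power)
      moreover have "fact (2 * m) = real ((2 * m) choose m) * (fact m * fact m)"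
        using binomial_fact_lemma[of m "2 * m"]
        by (metis (no_types, lifting) add_diff_cancel_right' le_add2 mult.commute mult_2 of_nat_fact of_nat_mult)
      ultimately show ?thesis by (simp add: power_mult mult_right_mono)
    qed
    have "n = 2 * m \<or> n = Suc (2 * m)" unfolding m_def by linarith
    thus ?thesis
    proof
      assume n: "n = 2 * m"
      have "1 * (4 ^ m * (fact m * fact m)) \<le> real n * ((4::real) ^ m * (fact m * fact m))"
        using assms by (intro mult_right_mono) auto
      thus ?thesis using c unfolding n by linarith
    next
      assume n: "n = Suc (2 * m)"
      have "fact n = real n * fact (2 * m)" unfolding n by simp
      thus ?thesis using c by (simp add: mult_left_mono)
    qed
  qed
  hence "ln (fact n) \<le> ln (real n * (4 ^ m * (fact m * fact m)))"
    using assms by (subst ln_le_cancel_iff) auto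
  also have "\<dots> = ln n + m * ln 4 + 2 * ln (fact m)"
    using assms by (simp add: ln_mult ln_realpow)
  also have "ln 4 = 2 * ln (2::real)" using ln_realpow[of 2 2] by simp
  finally have "ln (fact n) - 2 * ln (fact m) \<le> ln n + real m * (2 * ln 2)" by simp
  also have "real m * (2 * ln 2) \<le> real m * 2" using ln_2_less_1 by (intro mult_left_mono) auto
  also have "ln n + real m * 2 \<le> 2 * real n"
    using assms ln_le_minus_one[of "real n"] unfolding m_def by linarith
  finally show ?thesis by (simp add: m_def)
qed

text \<open>Each halving costs at most \<open>2 * n\<close>; the geometric series of halvings
  doubles this.\<close>

lemma chebyshev_psi_le: "chebyshev_psi n \<le> 4 * real n"
proof (induction n rule: less_induct)
  case (less n)
  show ?case
  proof (cases "n = 0")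
    case True
    thus ?thesis by (simp add: chebyshev_psi_def)
  next
    case False
    hence "chebyshev_psi (n div 2) \<le> 4 * real (n div 2)" by (intro less) auto
    moreover have "real (n div 2) \<le> real n / 2" by linarith
    ultimately show ?thesis
      using chebyshev_psi_halve[of n] ln_fact_halve_le[of n] False by simp
  qed
qed

section \<open>Mertens' estimate and weighted forms of it\<close>

definition mertens_sum :: "nat \<Rightarrow> real" where
  "mertens_sum n = (\<Sum>d=1..n. mangoldt d / real d)"

text \<open>Replacing \<open>n div d\<close> by \<open>n / d\<close> in the sum for
  \<open>ln (fact n)\<close> changes it by at most \<open>chebyshev_psi n\<close>. The constant 4 is
  Chebyshev's, the constant 1 comes from \<open>ln_fact_ge\<close>.\<close>

lemma mertens_bounds:
  assumes "n > 0"
  shows "mertens_sum n \<ge> ln n - 1" "mertens_sum n \<le> ln n + 4"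
proof -
  have div_bounds: "real (n div d) \<le> n / d" "n / d \<le> real (n div d) + 1" for d
  proof -
    have "real n / real d = real (n div d) + real (n mod d) / real d"
      using of_nat_of_nat_div_aux[of n d, where ?'a = real] by simp
    moreover have "real (n mod d) / real d \<le> 1" by (cases "d = 0") (auto simp: divide_le_eq_1 less_imp_le)
    ultimately show "real (n div d) \<le> n / d" "n / d \<le> real (n div d) + 1" by simp_all
  qed
  have "real n * ln n - n \<le> (\<Sum>d=1..n. mangoldt d * real (n div d))"
    using ln_fact_ge[of n] ln_fact_eq_sum_mangoldt[of n] by simp
  also have "\<dots> \<le> (\<Sum>d=1..n. mangoldt d * (n / d))"
    by (intro sum_mono mult_left_mono div_bounds mangoldt_nonneg)
  also have "\<dots> = n * mertens_sum n"
    unfolding mertens_sum_def sum_distrib_left by (simp add: algebra_simps)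
  finally have "real n * (ln n - 1) \<le> n * mertens_sum n" by (simp add: algebra_simps)
  thus "mertens_sum n \<ge> ln n - 1" using assms by simp
  have "n * mertens_sum n = (\<Sum>d=1..n. mangoldt d * (n / d))"
    unfolding mertens_sum_def sum_distrib_left by (simp add: algebra_simps)
  also have "\<dots> \<le> (\<Sum>d=1..n. mangoldt d * (real (n div d) + 1))"
    by (intro sum_mono mult_left_mono div_bounds mangoldt_nonneg)
  also have "\<dots> = ln (fact n) + chebyshev_psi n"
    unfolding ln_fact_eq_sum_mangoldt chebyshev_psi_def by (simp add: algebra_simps sum.distrib)
  also have "\<dots> \<le> n * (ln n + 4)"
    using ln_fact_le[of n] chebyshev_psi_le[of n] by (simp add: algebra_simps)
  finally show "mertens_sum n \<le> ln n + 4" using assms by simp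
qed

text \<open>The integral of \<open>t powr (\<epsilon> - 1)\<close> over one unit interval is
  compared with that of \<open>1 / t\<close>, the weight being frozen at the right end point. In
  terms of the ratio \<open>u\<close> of the two weights this is
  \<open>ln u \<le> u - 1\<close>.\<close>

lemma powr_diff_le_ln_diff:
  fixes d :: nat
  assumes "d > 0" "\<epsilon> > 0"
  shows "(real (Suc d) powr \<epsilon> - real d powr \<epsilon>) / \<epsilon> \<le> real (Suc d) powr \<epsilon> * (ln (Suc d) - ln d)"
proof -
  define u where "u = (real d / real (Suc d)) powr \<epsilon>"
  have u: "u > 0" using assms by (simp add: u_def)
  have "ln u = \<epsilon> * (ln d - ln (Suc d))"
    using assms by (simp add: u_def ln_powr ln_div del: of_nat_Suc)
  moreover have "ln u \<le> u - 1" using u by (rule ln_le_minus_one)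
  ultimately have "1 - u \<le> \<epsilon> * (ln (Suc d) - ln d)" by (simp add: algebra_simps)
  hence "real (Suc d) powr \<epsilon> * (1 - u) \<le> real (Suc d) powr \<epsilon> * (\<epsilon> * (ln (Suc d) - ln d))"
    by (intro mult_left_mono) auto
  moreover have "real (Suc d) powr \<epsilon> * u = real d powr \<epsilon>"
    unfolding u_def using assms by (simp add: powr_divide del: of_nat_Suc)
  ultimately show ?thesis using assms(2) by (simp add: field_simps del: of_nat_Suc)
qed

text \<open>Abel summation: with \<open>e n = mertens_sum n - ln n\<close>, the increments of \<open>ln\<close> contribute the
  integral of \<open>t powr (\<epsilon> - 1)\<close>, and those of \<open>e\<close> are absorbed by the boundedness of \<open>e\<close>.\<close>
lemma weighted_mertens_ge:
  fixes n :: nat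
  assumes "n > 0" "\<epsilon> > 0"
  shows "(\<Sum>d=1..n. mangoldt d * real d powr (\<epsilon> - 1))
           \<ge> (real n powr \<epsilon> - 1) / \<epsilon> - 5 * real n powr \<epsilon>"
proof -
  define e where "e n = mertens_sum n - ln (real n)" for n
  have e: "e n \<ge> -1" "e n \<le> 4" if "n > 0" for n
    using mertens_bounds[OF that] by (auto simp: e_def)
  \<comment> \<open>Summation by parts keeps the boundary term with \<open>e n\<close> and subtracts
    the values of \<open>e\<close> against the increments of the weight; the bound 4 for
    \<open>e\<close> makes that sum telescope.\<close>
  have "(real n powr \<epsilon> - 1) / \<epsilon> + e n * real n powr \<epsilon> - 4 * (real n powr \<epsilon> - 1)
          \<le> (\<Sum>d=1..n. mangoldt d * real d powr (\<epsilon> - 1))"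
    using assms(1)
  proof (induction n rule: nat_induct_non_zero)
    case 1
    show ?case by (simp add: e_def mertens_sum_def)
  next
    case (Suc n)
    let ?w = "\<lambda>n::nat. real n powr \<epsilon>"
    have step: "mangoldt (Suc n) * real (Suc n) powr (\<epsilon> - 1)
        = (e (Suc n) - e n) * ?w (Suc n) + ?w (Suc n) * (ln (Suc n) - ln n)"
    proof -
      have "mertens_sum (Suc n) = mertens_sum n + mangoldt (Suc n) / Suc n"
        by (simp add: mertens_sum_def)
      thus ?thesis unfolding e_def by (simp add: powr_diff algebra_simps del: of_nat_Suc)
    qed
    have "e n * (?w (Suc n) - ?w n) \<le> 4 * (?w (Suc n) - ?w n)"
      using e[OF Suc.hyps] assms(2) by (intro mult_right_mono) (auto intro!: powr_mono2)
    moreover have "(?w (Suc n) - ?w n) / \<epsilon> \<le> ?w (Suc n) * (ln (Suc n) - ln n)"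
      by (rule powr_diff_le_ln_diff) (use Suc.hyps assms in auto)
    ultimately show ?case using Suc.IH step by (simp add: algebra_simps diff_divide_distrib del: of_nat_Suc)
  qed
  moreover have "-1 * real n powr \<epsilon> \<le> e n * real n powr \<epsilon>"
    using e[OF assms(1)] by (intro mult_right_mono) auto
  ultimately show ?thesis by simp
qed

text \<open>A crude bound, used in \<open>main_sum_ge\<close> to control the loss from a factor
  close to 1.\<close>

lemma weighted_mertens_le:
  fixes n :: nat
  assumes "n > 0" "\<epsilon> > 0"
  shows "(\<Sum>d=1..n. mangoldt d * real d powr (\<epsilon> - 1)) \<le> real n powr \<epsilon> * (ln n + 4)"
proof -
  have "(\<Sum>d=1..n. mangoldt d * real d powr (\<epsilon> - 1))
      \<le> (\<Sum>d=1..n. real n powr \<epsilon> * (mangoldt d / real d))"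
  proof (rule sum_mono)
    fix d assume d: "d \<in> {1..n}"
    have "mangoldt d * real d powr (\<epsilon> - 1) = real d powr \<epsilon> * (mangoldt d / real d)"
      using d by (simp add: powr_diff)
    also have "\<dots> \<le> real n powr \<epsilon> * (mangoldt d / real d)"
      using d assms by (intro mult_right_mono powr_mono2) (auto simp: mangoldt_nonneg)
    finally show "mangoldt d * real d powr (\<epsilon> - 1) \<le> real n powr \<epsilon> * (mangoldt d / real d)" .
  qed
  also have "\<dots> = real n powr \<epsilon> * mertens_sum n"
    by (simp add: mertens_sum_def sum_distrib_left)
  also have "\<dots> \<le> real n powr \<epsilon> * (ln n + 4)"
    using mertens_bounds[OF assms(1)] by (intro mult_left_mono) auto
  finally show ?thesis .
qed

section \<open>Positive functions on a family of characters\<close>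

text \<open>An abstract list of characters. Conjugation must be realised by one argument
  \<open>b\<close> common to all indices, and orthogonality enters only as the sign of the sums over
  the family.\<close>

locale character_family =
  fixes N :: nat and ch :: "nat \<Rightarrow> nat \<Rightarrow> complex"
  assumes N_pos: "N > 0"
    and chi_1: "ch j 1 = 1"
    and chi_mult: "ch j (a * b) = ch j a * ch j b"
    and chi_cnj: "\<exists>b. \<forall>j. cnj (ch j a) = ch j b"
    and sum_chi: "Re (\<Sum>j<N. ch j a) \<ge> 0"
begin

text \<open>The cone of nonnegative combinations, as functions of the index \<open>j\<close> of the
  character. Building it monomial by monomial turns its closure properties into inductions.\<close>

inductive pos :: "(nat \<Rightarrow> complex) \<Rightarrow> bool" where
  zero: "pos (\<lambda>j. 0)"
| add_monom: "u \<ge> 0 \<Longrightarrow> pos \<phi> \<Longrightarrow> pos (\<lambda>j. of_real u * ch j a + \<phi> j)"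

lemma pos_monom: "u \<ge> 0 \<Longrightarrow> pos (\<lambda>j. of_real u * ch j a)"
  using add_monom[OF _ zero, of u a] by simp

lemma pos_chi: "pos (\<lambda>j. ch j a)"
  using pos_monom[of 1 a] by simp

lemma pos_const: "u \<ge> 0 \<Longrightarrow> pos (\<lambda>j. of_real u)"
  using pos_monom[of u 1] unfolding chi_1 by simp

lemma pos_1: "pos (\<lambda>j. 1)"
  using pos_const[of 1] by simp

lemma pos_add: "pos \<phi> \<Longrightarrow> pos \<psi> \<Longrightarrow> pos (\<lambda>j. \<phi> j + \<psi> j)"
  by (induction rule: pos.induct) (auto simp: add.assoc intro: add_monom)

lemma pos_monom_mult: "pos \<phi> \<Longrightarrow> u \<ge> 0 \<Longrightarrow> pos (\<lambda>j. of_real u * ch j a * \<phi> j)"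
proof (induction rule: pos.induct)
  case (add_monom v \<phi> b)
  hence "pos (\<lambda>j. of_real (u * v) * ch j (a * b) + of_real u * ch j a * \<phi> j)"
    by (intro pos.add_monom) auto
  thus ?case by (simp add: chi_mult algebra_simps)
qed (auto intro: zero)

lemma pos_mult: "pos \<phi> \<Longrightarrow> pos \<psi> \<Longrightarrow> pos (\<lambda>j. \<phi> j * \<psi> j)"
proof (induction rule: pos.induct)
  case (add_monom u \<phi> a)
  have "pos (\<lambda>j. of_real u * ch j a * \<psi> j + \<phi> j * \<psi> j)"
    by (intro pos_add pos_monom_mult add_monom)
  thus ?case by (simp add: algebra_simps)
qed (auto intro: zero)

lemma pos_cmult: "u \<ge> 0 \<Longrightarrow> pos \<phi> \<Longrightarrow> pos (\<lambda>j. of_real u * \<phi> j)"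
  using pos_mult[OF pos_const] by simp

lemma pos_power: "pos \<phi> \<Longrightarrow> pos (\<lambda>j. \<phi> j ^ k)"
  by (induction k) (auto intro: pos_1 pos_mult)

lemma pos_cnj: "pos \<phi> \<Longrightarrow> pos (\<lambda>j. cnj (\<phi> j))"
proof (induction rule: pos.induct)
  case (add_monom u \<phi> a)
  obtain b where "\<And>j. cnj (ch j a) = ch j b" using chi_cnj by blast
  thus ?case using add_monom by (auto intro: pos.add_monom)
qed (auto intro: zero)

lemma pos_sum: "(\<And>i. i \<in> I \<Longrightarrow> pos (\<phi> i)) \<Longrightarrow> pos (\<lambda>j. \<Sum>i\<in>I. \<phi> i j)"
  by (induction I rule: infinite_finite_induct) (auto intro: zero pos_add)

lemma pos_prod: "(\<And>i. i \<in> I \<Longrightarrow> pos (\<phi> i)) \<Longrightarrow> pos (\<lambda>j. \<Prod>i\<in>I. \<phi> i j)"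
  by (induction I rule: infinite_finite_induct) (auto intro: pos_1 pos_mult)

lemma pos_sum_nonneg: "pos \<phi> \<Longrightarrow> Re (\<Sum>j<N. \<phi> j) \<ge> 0"
proof (induction rule: pos.induct)
  case (add_monom u \<phi> a)
  have "Re (\<Sum>j<N. of_real u * ch j a + \<phi> j) = u * Re (\<Sum>j<N. ch j a) + Re (\<Sum>j<N. \<phi> j)"
    by (simp add: sum.distrib sum_distrib_left)
  thus ?case using add_monom sum_chi[of a] by simp
qed simp

text \<open>Membership of \<open>f - 1\<close> expresses a constant coefficient of at least 1. It
  survives products because \<open>f g - 1 = (f - 1) (g - 1) + (f - 1) + (g - 1)\<close>.\<close>

lemma pos_prod_minus_1:
  assumes "\<And>i. i \<in> I \<Longrightarrow> pos (\<lambda>j. \<phi> i j - 1)"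
  shows "pos (\<lambda>j. (\<Prod>i\<in>I. \<phi> i j) - 1)"
  using assms
proof (induction I rule: infinite_finite_induct)
  case (insert i I)
  have "pos (\<lambda>j. (\<phi> i j - 1) * ((\<Prod>i\<in>I. \<phi> i j) - 1) + (\<phi> i j - 1) + ((\<Prod>i\<in>I. \<phi> i j) - 1))"
    using insert by (intro pos_add pos_mult) auto
  thus ?case using insert.hyps by (simp add: algebra_simps)
qed (auto intro: zero)

text \<open>The exponent \<open>n\<close> is the same for all characters, so that one finite
  geometric sum represents an Euler factor for every \<open>j\<close> at once.\<close>

definition unit :: "nat \<Rightarrow> bool" where
  "unit a \<longleftrightarrow> (\<exists>n>0. \<forall>j. ch j a ^ n = 1)"

lemma unit_norm: "unit a \<Longrightarrow> norm (ch j a) = 1"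
  unfolding unit_def by (metis norm_one norm_power norm_ge_zero power_eq_1_iff gr_implies_not0 real_norm_def abs_norm_cancel)

section \<open>Euler factors and the resonance inequality\<close>

definition euler_factor :: "real \<Rightarrow> nat \<Rightarrow> nat \<Rightarrow> complex" where
  "euler_factor lam p j = 1 / (1 - of_real lam * ch j p)"

context
  fixes lam :: real
  assumes lam: "0 \<le> lam" "lam < 1"
begin

lemma euler_denominator_nonzero: 
  assumes "unit p"
  shows "1 - of_real lam * ch j p \<noteq> 0"
proof
  assume "1 - of_real lam * ch j p = 0"
  hence "norm (of_real lam * ch j p) = 1" by simp
  thus False using unit_norm[OF assms] lam by (simp add: norm_mult)
qed

text \<open>As the powers of \<open>ch j p\<close> are periodic with period \<open>n\<close>, the
  infinite geometric series folds into \<open>n\<close> terms divided by \<open>1 - lam ^ n\<close>.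
  This keeps the infinite resonator inside a cone of finite sums.\<close>

lemma pos_euler_factor:
  assumes "unit p"
  shows "pos (euler_factor lam p)"
proof -
  obtain n where n: "n > 0" "\<And>j. ch j p ^ n = 1" using assms by (auto simp: unit_def)
  have ln: "1 - lam ^ n > 0" using lam n by (simp add: power_less_one_iff)
  have eq: "euler_factor lam p j
          = of_real (1 / (1 - lam ^ n)) * (\<Sum>k<n. (of_real lam * ch j p) ^ k)" for j
  proof -
    have "(1 - of_real lam * ch j p) * (\<Sum>k<n. (of_real lam * ch j p) ^ k) = of_real (1 - lam ^ n)"
      by (subst one_diff_power_eq[symmetric]) (simp add: power_mult_distrib n)
    moreover have "complex_of_real (1 - lam ^ n) \<noteq> 0"
      using ln unfolding of_real_eq_0_iff by simp
    ultimately show ?thesis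
      using euler_denominator_nonzero[OF assms, of j] unfolding euler_factor_def of_real_divide
      by (simp add: divide_simps mult_ac)
  qed
  have "pos (\<lambda>j. of_real (1 / (1 - lam ^ n)) * (\<Sum>k<n. (of_real lam * ch j p) ^ k))"
    using lam ln by (intro pos_cmult pos_sum pos_power pos_chi) auto
  thus ?thesis unfolding eq[symmetric] .
qed

lemma pos_euler_factor_minus_1:
  assumes "unit p"
  shows "pos (\<lambda>j. euler_factor lam p j - 1)"
proof -
  have "euler_factor lam p j - 1 = of_real lam * ch j p * euler_factor lam p j" for j
    using euler_denominator_nonzero[OF assms, of j]
    by (simp add: euler_factor_def field_simps)
  thus ?thesis using pos_monom_mult[OF pos_euler_factor[OF assms] lam(1)] by simp
qed

text \<open>On the unit circle \<open>z - lam = z * cnj (1 - lam * z)\<close>, so the conjugate Euler factor turns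
  the twist \<open>ch j p - lam\<close> into a function with nonnegative coefficients.\<close>
lemma pos_cnj_euler_factor_twist:
  assumes "unit p"
  shows "pos (\<lambda>j. cnj (euler_factor lam p j) * (ch j p ^ k - of_real lam ^ k))"
proof -
  have eq: "cnj (euler_factor lam p j) * (ch j p ^ k - of_real lam ^ k)
      = ch j p * (\<Sum>i<k. of_real lam ^ (k - Suc i) * ch j p ^ i)" for j
  proof -
    have "ch j p * cnj (ch j p) = 1"
      using unit_norm[OF assms, of j] by (simp add: complex_norm_square[symmetric])
    hence "ch j p - of_real lam = ch j p * cnj (1 - of_real lam * ch j p)"
      by (simp add: algebra_simps)
    moreover have "cnj (1 - of_real lam * ch j p) \<noteq> 0"
      using euler_denominator_nonzero[OF assms, of j] by (metis complex_cnj_zero_iff)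
    ultimately have "cnj (euler_factor lam p j) * (ch j p - of_real lam) = ch j p"
      by (simp add: euler_factor_def)
    moreover have "ch j p ^ k - of_real lam ^ k
        = (ch j p - of_real lam) * (\<Sum>i<k. of_real lam ^ (k - Suc i) * ch j p ^ i)"
      by (simp add: power_diff_sumr2 mult.commute)
    ultimately show ?thesis by (metis mult.assoc)
  qed
  have "pos (\<lambda>j. ch j p * (\<Sum>i<k. of_real (lam ^ (k - Suc i)) * ch j p ^ i))"
    using lam by (intro pos_mult pos_sum pos_power pos_chi pos_const) auto
  thus ?thesis unfolding eq by simp
qed

text \<open>For a set \<open>B\<close> of primes this is the sum of
  \<open>lam ^ \<Omega>(n) * ch j n\<close> over all \<open>n\<close> composed of primes in
  \<open>B\<close>, with \<open>\<Omega>\<close> counting prime factors with multiplicity.\<close>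

definition resonator :: "nat set \<Rightarrow> nat \<Rightarrow> complex" where
  "resonator B j = (\<Prod>p\<in>B. euler_factor lam p j)"

text \<open>Here \<open>l\<close> stands for \<open>L\<close> and \<open>m\<close> for a corrected
  \<open>- L'\<close>. Under the weight \<open>|R l|^2\<close> the mean of \<open>ch j d\<close> at
  a prime power \<open>d = p ^ k\<close> is at least \<open>lam ^ k\<close>, so the mean of
  \<open>P\<close> is at least \<open>mu\<close> times the sum of its coefficients.\<close>

lemma resonance:
  assumes B: "finite B" "\<And>p. p \<in> B \<Longrightarrow> unit p"
    and D: "\<And>d. d \<in> D \<Longrightarrow> w d \<ge> 0 \<and> (w d > 0 \<longrightarrow> (\<exists>p\<in>B. \<exists>k. d = p ^ k \<and> lam ^ k \<ge> mu))"
    and l: "pos l" and m: "pos (\<lambda>j. m j - (\<Sum>d\<in>D. of_real (w d) * ch j d) * l j)"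
  shows "mu * (\<Sum>d\<in>D. w d) * (\<Sum>j<N. norm (resonator B j * l j) ^ 2)
           \<le> (\<Sum>j<N. norm (resonator B j) ^ 2 * Re (m j * cnj (l j)))"
proof -
  let ?R = "resonator B"
  have R: "pos ?R" unfolding resonator_def[abs_def] by (intro pos_prod pos_euler_factor B)
  have chi_pow: "ch j (p ^ k) = ch j p ^ k" for j p k
    by (induction k) (auto simp: chi_1[simplified] chi_mult)
  let ?W = "\<lambda>j. norm (?R j * l j) ^ 2"
  have twist: "mu * w d * (\<Sum>j<N. ?W j) \<le> w d * (\<Sum>j<N. ?W j * Re (ch j d))"
    if d: "d \<in> D" for d
  proof (cases "w d > 0")
    case True
    then obtain p k where p: "p \<in> B" "d = p ^ k" "lam ^ k \<ge> mu" using D[OF d] by blast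
    \<comment> \<open>Only the conjugate factor at \<open>p\<close> is spent on the twist;
      \<open>Q\<close> collects the others.\<close>
    define Q where "Q j = (\<Prod>p\<in>B - {p}. euler_factor lam p j)" for j
    have Q: "pos Q" unfolding Q_def[abs_def] by (intro pos_prod pos_euler_factor B) auto
    have RQ: "?R j = euler_factor lam p j * Q j" for j
      unfolding resonator_def Q_def using prod.remove[OF B(1) p(1)] by blast
    have twisted: "pos (\<lambda>j. (?R j * cnj (Q j) * (l j * cnj (l j)))
             * (cnj (euler_factor lam p j) * (ch j p ^ k - of_real lam ^ k)))"
      by (intro pos_mult pos_cnj Q R l pos_cnj_euler_factor_twist B p)
    have eq: "(?R j * cnj (Q j) * (l j * cnj (l j)))
             * (cnj (euler_factor lam p j) * (ch j p ^ k - of_real lam ^ k))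
        = of_real (?W j) * (ch j d - of_real (lam ^ k))" for j
    proof -
      have "of_real (?W j) = (?R j * cnj (Q j) * (l j * cnj (l j))) * cnj (euler_factor lam p j)"
        unfolding complex_norm_square by (simp add: RQ)
      thus ?thesis by (simp add: p chi_pow)
    qed
    have "Re (\<Sum>j<N. of_real (?W j) * (ch j d - of_real (lam ^ k))) \<ge> 0"
      using pos_sum_nonneg[OF twisted] unfolding eq .
    hence "lam ^ k * (\<Sum>j<N. ?W j) \<le> (\<Sum>j<N. ?W j * Re (ch j d))"
      by (simp add: algebra_simps sum_subtractf sum_distrib_left del: of_real_power)
    moreover have "mu * (\<Sum>j<N. ?W j) \<le> lam ^ k * (\<Sum>j<N. ?W j)"
      by (intro mult_right_mono p sum_nonneg) auto
    ultimately have "mu * (\<Sum>j<N. ?W j) \<le> (\<Sum>j<N. ?W j * Re (ch j d))" by linarith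
    hence "w d * (mu * (\<Sum>j<N. ?W j)) \<le> w d * (\<Sum>j<N. ?W j * Re (ch j d))"
      using True by (intro mult_left_mono) auto
    thus ?thesis by (simp add: mult_ac)
  next
    case False
    hence "w d = 0" using D[OF d] by force
    thus ?thesis by simp
  qed
  let ?P = "\<lambda>j. \<Sum>d\<in>D. of_real (w d) * ch j d"
  have "mu * (\<Sum>d\<in>D. w d) * (\<Sum>j<N. ?W j) = (\<Sum>d\<in>D. mu * w d * (\<Sum>j<N. ?W j))"
    by (simp only: sum_distrib_left[symmetric] sum_distrib_right[symmetric])
  also have "\<dots> \<le> (\<Sum>d\<in>D. w d * (\<Sum>j<N. ?W j * Re (ch j d)))"
    by (intro sum_mono twist)
  also have "\<dots> = (\<Sum>d\<in>D. \<Sum>j<N. ?W j * (w d * Re (ch j d)))"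
    by (simp add: sum_distrib_left mult_ac)
  also have "\<dots> = (\<Sum>j<N. ?W j * Re (?P j))"
    by (subst sum.swap) (simp add: sum_distrib_left)
  also have "\<dots> \<le> (\<Sum>j<N. norm (?R j) ^ 2 * Re (m j * cnj (l j)))"
  proof -
    \<comment> \<open>Multiplying the hypothesis on \<open>m\<close> by \<open>|R|^2 * cnj l\<close>
      stays in the cone and allows \<open>P |l|^2\<close> to be replaced by
      \<open>m * cnj l\<close>.\<close>
    have "pos (\<lambda>j. ?R j * cnj (?R j) * cnj (l j) * (m j - ?P j * l j))"
      by (intro pos_mult pos_cnj R l m)
    hence "Re (\<Sum>j<N. ?R j * cnj (?R j) * cnj (l j) * (m j - ?P j * l j)) \<ge> 0"
      by (rule pos_sum_nonneg)
    also have "(\<lambda>j. ?R j * cnj (?R j) * cnj (l j) * (m j - ?P j * l j))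
        = (\<lambda>j. of_real (norm (?R j) ^ 2) * (m j * cnj (l j)) - of_real (?W j) * ?P j)"
      unfolding complex_norm_square by (rule ext) (simp add: algebra_simps)
    finally have "0 \<le> Re (\<Sum>j<N. of_real (norm (?R j) ^ 2) * (m j * cnj (l j)) - of_real (?W j) * ?P j)" .
    moreover have "Re (of_real x * z) = x * Re z" for x z by simp
    ultimately show ?thesis
      by (simp only: Re_sum minus_complex.simps sum_subtractf le_diff_eq add_0)
  qed
  finally show ?thesis .
qed

text \<open>Writing \<open>R l = 1 + f\<close> with \<open>f\<close> in the cone,
  \<open>|R l|^2 - 1 = f + cnj f + |f|^2\<close> is in the cone as well.\<close>

lemma resonator_weight_ge:
  assumes B: "\<And>p. p \<in> B \<Longrightarrow> unit p" and l: "pos (\<lambda>j. l j - 1)"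
  shows "(\<Sum>j<N. norm (resonator B j * l j) ^ 2) \<ge> real N"
proof -
  let ?R = "resonator B"
  define f where "f j = (?R j - 1) * (l j - 1) + (?R j - 1) + (l j - 1)" for j
  have f: "pos f" unfolding f_def[abs_def] resonator_def
    by (intro pos_add pos_mult l pos_prod_minus_1 pos_euler_factor_minus_1 B)
  have "pos (\<lambda>j. f j + cnj (f j) + f j * cnj (f j))"
    by (intro pos_add pos_mult pos_cnj f)
  hence "Re (\<Sum>j<N. f j + cnj (f j) + f j * cnj (f j)) \<ge> 0" by (rule pos_sum_nonneg)
  also have "(\<lambda>j. f j + cnj (f j) + f j * cnj (f j)) = (\<lambda>j. of_real (norm (?R j * l j) ^ 2) - 1)"
    unfolding complex_norm_square by (rule ext) (simp add: f_def algebra_simps)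
  finally show ?thesis by (simp add: sum_subtractf)
qed

end

end

section \<open>The characters modulo a prime\<close>

text \<open>The discrete logarithm to base \<open>g\<close>. The chosen representative is arbitrary
  modulo \<open>q - 1\<close>, which is harmless under
  \<open>cis (2 * pi * j * _ / (q - 1))\<close>.\<close>

definition dlog :: "nat \<Rightarrow> nat \<Rightarrow> nat \<Rightarrow> nat" where
  "dlog q g a = (SOME k. [g ^ k = a] (mod q))"

text \<open>The \<open>j\<close>-th power of a generator of the character group when
  \<open>q\<close> is prime and \<open>g\<close> a primitive root; \<open>j = 0\<close> is the
  principal character.\<close>

definition power_character :: "nat \<Rightarrow> nat \<Rightarrow> nat \<Rightarrow> nat \<Rightarrow> complex" where
  "power_character q g j a = (if q dvd a then 0 else cis (2 * pi * real (j * dlog q g a) / real (q - 1)))"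

lemma cis_root_cong:
  assumes "[m = n] (mod N)" "N > 0"
  shows "cis (2 * pi * real m / real N) = cis (2 * pi * real n / real N)"
proof -
  have *: "cis (2 * pi * real m / real N) = cis (2 * pi * real (m mod N) / real N)" for m
  proof -
    have "real m = real (m mod N) + real N * real (m div N)"
      by (metis mod_mult_div_eq of_nat_add of_nat_mult)
    hence "2 * pi * real m / real N
             = 2 * pi * real (m mod N) / real N + 2 * pi * real (m div N)"
      using assms(2) by (simp add: field_simps)
    thus ?thesis by (simp flip: cis_mult)
  qed
  show ?thesis using assms(1) *[of m] *[of n] by (simp add: cong_def)
qed

context
  fixes q g :: nat
  assumes q: "prime q" and g: "residue_primroot q g"
begin

lemma coprime_iff: "coprime a q \<longleftrightarrow> \<not> q dvd a"
proof
  assume "coprime a q"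
  thus "\<not> q dvd a" using q not_prime_unit by (metis coprime_common_divisor dvd_refl)
next
  assume "\<not> q dvd a"
  thus "coprime a q" using prime_imp_coprime[OF q] by (subst coprime_commute) blast
qed

lemma ord_primroot: "ord q g = q - 1"
  using q g by (simp add: residue_primroot_def totient_prime)

lemma coprime_primroot: "coprime q g"
  using g by (simp add: residue_primroot_def)

lemma dlog:
  assumes "\<not> q dvd a"
  shows "[g ^ dlog q g a = a] (mod q)"
proof -
  have "coprime (a mod q) q" using assms by (simp add: coprime_iff dvd_mod_iff)
  moreover have "a mod q > 0" using assms by (simp add: mod_greater_zero_iff_not_dvd)
  moreover have "a mod q \<le> q" using prime_gt_0_nat[OF q] by (intro less_imp_le mod_less_divisor)
  ultimately have "a mod q \<in> totatives q" by (simp add: in_totatives_iff)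
  hence "a mod q \<in> (\<lambda>i. g ^ i mod q) ` {..<totient q}"
    using residue_primroot_is_generator[OF prime_gt_1_nat[OF q] g] by (simp add: bij_betw_def)
  hence "\<exists>k. [g ^ k = a] (mod q)" by (auto simp: cong_def)
  thus ?thesis unfolding dlog_def by (rule someI_ex)
qed

lemma dlog_eqI:
  assumes "[g ^ k = a] (mod q)" "\<not> q dvd a"
  shows "[dlog q g a = k] (mod (q - 1))"
  using order_divides_expdiff[OF coprime_primroot] cong_trans[OF dlog[OF assms(2)] cong_sym[OF assms(1)]]
    ord_primroot by simp

lemma power_character_eq:
  assumes "[g ^ k = a] (mod q)" "\<not> q dvd a"
  shows "power_character q g j a = cis (2 * pi * real (j * k) / real (q - 1))"
proof -
  have "[j * dlog q g a = j * k] (mod (q - 1))" by (intro cong_mult dlog_eqI assms cong_refl)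
  from cis_root_cong[OF this] show ?thesis
    using assms prime_gt_1_nat[OF q] unfolding power_character_def by (metis zero_less_diff)
qed

lemma power_character_1: "power_character q g j 1 = 1"
  using power_character_eq[of 0 1 j] prime_gt_1_nat[OF q] by simp

lemma power_character_mult:
  "power_character q g j (a * b) = power_character q g j a * power_character q g j b"
proof (cases "q dvd a \<or> q dvd b")
  case False
  hence "\<not> q dvd a * b" using q by (simp add: prime_dvd_mult_iff)
  moreover have "[g ^ (dlog q g a + dlog q g b) = a * b] (mod q)"
    unfolding power_add using False by (intro cong_mult dlog) auto
  ultimately have "power_character q g j (a * b)
      = cis (2 * pi * real (j * (dlog q g a + dlog q g b)) / real (q - 1))"
    by (intro power_character_eq) auto
  thus ?thesis using False
    by (simp add: power_character_def cis_mult algebra_simps add_divide_distrib)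
qed (auto simp: power_character_def)

lemma power_character_cong:
  assumes "[a = b] (mod q)"
  shows "power_character q g j a = power_character q g j b"
proof (cases "q dvd a")
  case True
  hence "q dvd b" using assms cong_dvd_iff by blast
  thus ?thesis using True by (simp add: power_character_def)
next
  case False
  hence nb: "\<not> q dvd b" using assms cong_dvd_iff by blast
  have "[g ^ dlog q g a = b] (mod q)" using cong_trans[OF dlog[OF False] assms] .
  from power_character_eq[OF this nb] False show ?thesis by (simp add: power_character_def)
qed

lemma power_character_eq_0_iff: "power_character q g j a = 0 \<longleftrightarrow> q dvd a"
  by (simp add: power_character_def)

lemma dirichlet_power_character: "dirichlet_character q (power_character q g j)"
  unfolding dirichlet_character_def coprime_iff
  using power_character_1 power_character_mult power_character_eq_0_iff
    power_character_cong[of "a + q" a for a] by (auto simp: cong_def)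

lemma power_character_0: "\<not> q dvd a \<Longrightarrow> power_character q g 0 a = 1"
  by (simp add: power_character_def)

text \<open>The primitive root \<open>g\<close> is the witness: its value is 1 only if
  \<open>q - 1\<close> divides \<open>j\<close>.\<close>

lemma nonprincipal_power_character:
  assumes "0 < j" "j < q - 1"
  shows "power_character q g j \<in> nonprincipal_characters q"
proof -
  have g': "\<not> q dvd g"
    using coprime_primroot prime_gt_1_nat[OF q] by (metis coprime_absorb_left nat_dvd_1_iff_1 nat_neq_iff)
  have "power_character q g j g = cis (2 * pi * real j / real (q - 1))"
    using power_character_eq[of 1 g j] g' by simp
  also have "\<dots> \<noteq> 1"
  proof
    assume "cis (2 * pi * real j / real (q - 1)) = 1"
    hence "cos (2 * pi * real j / real (q - 1)) = 1" by (simp add: complex_eq_iff)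
    then obtain n :: int where "2 * pi * real j / real (q - 1) = real_of_int n * 2 * pi"
      unfolding cos_one_2pi_int by auto
    hence "(2 * pi) * (real j / real (q - 1)) = (2 * pi) * real_of_int n" by (simp add: mult_ac)
    hence "real j / real (q - 1) = real_of_int n" by (subst (asm) mult_cancel_left) simp
    hence "real j = n * real (q - 1)" using assms by (simp add: divide_eq_eq)
    hence "int j = n * int (q - 1)" by (metis of_int_eq_iff of_int_mult of_int_of_nat_eq)
    hence "int (q - 1) dvd int j" by simp
    hence "q - 1 dvd j" by presburger
    thus False using assms nat_dvd_not_less by blast
  qed
  finally have "power_character q g j g \<noteq> principal_character q g"
    using coprime_primroot by (simp add: principal_character_def coprime_commute)
  thus ?thesis using dirichlet_power_character by (auto simp: nonprincipal_characters_def)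
qed

lemma power_character_power: "power_character q g j (a ^ k) = power_character q g j a ^ k"
  using dirichlet_character_power[OF dirichlet_power_character] .

lemma power_character_unit: 
  assumes "\<not> q dvd a"
  shows "power_character q g j a ^ (q - 1) = 1"
proof -
  have "coprime a q" using assms by (simp add: coprime_iff)
  thus ?thesis
    using dirichlet_character_root_of_unity[OF dirichlet_power_character] q
    by (simp add: totient_prime)
qed

text \<open>For invertible \<open>a\<close>, conjugation is inversion modulo \<open>q\<close>, that
  is \<open>a ^ (q - 2)\<close> for every \<open>j\<close>. The sum over \<open>j\<close> is
  geometric in the value at index 1, hence 0 unless that value is 1.\<close>

lemma character_family_power_character: "character_family (q - 1) (power_character q g)"
proof
  show "q - 1 > 0" using prime_gt_1_nat[OF q] by simp
  show "power_character q g j 1 = 1" for j by (rule power_character_1)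
  show "power_character q g j (a * b) = power_character q g j a * power_character q g j b" for j a b
    by (rule power_character_mult)
  show "\<exists>b. \<forall>j. cnj (power_character q g j a) = power_character q g j b" for a
  proof (cases "q dvd a")
    case True
    thus ?thesis by (intro exI[of _ a]) (simp add: power_character_def)
  next
    case False
    have "cnj (power_character q g j a) = power_character q g j (a ^ (q - 2))" for j
    proof -
      have "power_character q g j a * power_character q g j a ^ (q - 2) = 1"
        using power_character_unit[OF False, of j] prime_gt_1_nat[OF q]
        by (simp flip: power_Suc add: Suc_diff_Suc numeral_2_eq_2)
      moreover have "cnj (power_character q g j a) * power_character q g j a = 1"
        using False by (simp add: power_character_def cis_cnj cis_mult)
      ultimately have "cnj (power_character q g j a) = power_character q g j a ^ (q - 2)"
        by (metis mult.assoc mult_1_left mult_1_right)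
      thus ?thesis unfolding power_character_power .
    qed
    thus ?thesis by blast
  qed
  show "Re (\<Sum>j<q - 1. power_character q g j a) \<ge> 0" for a
  proof (cases "q dvd a")
    case False
    define z where "z = power_character q g 1 a"
    have "power_character q g j a = z ^ j" for j
      using False unfolding z_def power_character_def by (simp add: Complex.DeMoivre mult_ac)
    moreover have "Re (\<Sum>j<q - 1. z ^ j) \<ge> 0"
    proof (cases "z = 1")
      case False
      have "z ^ (q - 1) = 1"
        unfolding z_def by (rule power_character_unit[OF \<open>\<not> q dvd a\<close>])
      hence "(\<Sum>j<q - 1. z ^ j) = 0" unfolding geometric_sum[OF False] by simp
      thus ?thesis by (simp only: zero_complex.sel)
    qed simp
    ultimately show ?thesis by simp
  qed (simp add: power_character_def)
qed

end

section \<open>L-values as sums over a residue system\<close>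

text \<open>The weight of the class of \<open>a\<close> beyond the first period. The sum of
  \<open>f\<close> itself may diverge; the subtracted value at the end of each period does not
  depend on \<open>a\<close>.\<close>

definition tail_weight :: "nat \<Rightarrow> (real \<Rightarrow> real) \<Rightarrow> nat \<Rightarrow> real" where
  "tail_weight q f a = (\<Sum>k. f (real (a + Suc k * q)) - f (real (Suc (Suc k) * q)))"

text \<open>By monotonicity each term lies between 0 and the drop of \<open>f\<close> over its
  period, and these drops telescope.\<close>

lemma tail_weight:
  fixes f :: "real \<Rightarrow> real"
  assumes anti: "antimono_on {real q..} f" and nonneg: "\<And>x. x \<ge> real q \<Longrightarrow> f x \<ge> 0"
    and a: "a \<le> q"
  shows "summable (\<lambda>k. f (real (a + Suc k * q)) - f (real (Suc (Suc k) * q)))"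
    and "tail_weight q f a \<ge> 0" and "tail_weight q f a \<le> f (real q)"
proof -
  let ?t = "\<lambda>k. f (real (a + Suc k * q)) - f (real (Suc (Suc k) * q))"
  have le: "f y \<le> f x" if "real q \<le> x" "x \<le> y" for x y
    using monotone_onD[OF anti, of x y] that by auto
  have t: "?t k \<ge> 0" "?t k \<le> f (real (Suc k * q)) - f (real (Suc (Suc k) * q))" for k
    using a by (auto intro!: le simp flip: of_nat_mult of_nat_add of_nat_Suc)
  have bd: "(\<Sum>k<n. ?t k) \<le> f (real q)" for n
  proof -
    have "(\<Sum>k<n. ?t k) \<le> (\<Sum>k<n. f (real (Suc k * q)) - f (real (Suc (Suc k) * q)))"
      by (intro sum_mono t)
    also have "\<dots> = f (real q) - f (real (Suc n * q))"
      using sum_lessThan_telescope'[of "\<lambda>k. f (real (Suc k * q))" n] by simp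
    also have "\<dots> \<le> f (real q)" using nonneg[of "real (Suc n * q)"] by (simp del: of_nat_mult)
    finally show ?thesis .
  qed
  show sm: "summable ?t" by (rule bounded_imp_summable[OF t(1) bd[of "Suc n" for n, unfolded lessThan_Suc_atMost]])
  show "tail_weight q f a \<ge> 0" unfolding tail_weight_def by (rule suminf_nonneg[OF sm t(1)])
  show "tail_weight q f a \<le> f (real q)" unfolding tail_weight_def by (rule suminf_le_const[OF sm bd])
qed

text \<open>Since \<open>\<psi>\<close> sums to \<open>0\<close> over a full period, the constant \<open>f ((k + 1) q)\<close> may be subtracted
  from all values of \<open>f\<close> in the \<open>k\<close>-th period, which makes the series absolutely convergent.\<close>
lemma periodic_sum_limit:
  fixes f :: "real \<Rightarrow> real"
  assumes psi: "\<psi> \<in> nonprincipal_characters q" and q: "q > 0"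
    and anti: "antimono_on {real q..} f" and nonneg: "\<And>x. x \<ge> real q \<Longrightarrow> f x \<ge> 0"
  shows "(\<lambda>K. \<Sum>n<Suc K * q. \<psi> n * of_real (f (real n)))
           \<longlonglongrightarrow> (\<Sum>a<q. \<psi> a * of_real (f (real a) + tail_weight q f a))"
proof -
  have chi: "dirichlet_character q \<psi>" using psi by (simp add: nonprincipal_characters_def)
  have per: "\<psi> (a + k * q) = \<psi> a" for a k
    using dirichlet_character_mod[OF chi, of "a + k * q"] dirichlet_character_mod[OF chi, of a] by simp
  have block: "(\<Sum>n<m * q. F n) = (\<Sum>k<m. \<Sum>a<q. F (a + k * q))" for m and F :: "nat \<Rightarrow> complex"
  proof -
    have shift: "(\<Sum>n<M + r. F n) = (\<Sum>n<M. F n) + (\<Sum>a<r. F (a + M))" for M r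
      by (induction r) (simp_all add: algebra_simps)
    show ?thesis
    proof (induction m)
      case (Suc m)
      have "Suc m * q = m * q + q" by simp
      thus ?case using shift[of "m * q" q] Suc by (simp only: sum.lessThan_Suc)
    qed simp
  qed
  have eq: "(\<Sum>n<Suc K * q. \<psi> n * of_real (f (real n)))
      = (\<Sum>a<q. \<psi> a * of_real (f (real a)
          + (\<Sum>k<K. f (real (a + Suc k * q)) - f (real (Suc (Suc k) * q)))))" for K
  proof -
    have "(\<Sum>n<Suc K * q. \<psi> n * of_real (f (real n)))
        = (\<Sum>a<q. \<psi> a * of_real (f (real a)))
          + (\<Sum>k<K. \<Sum>a<q. \<psi> a * of_real (f (real (a + Suc k * q))))"
      unfolding block per sum.lessThan_Suc_shift by simp
    also have "(\<Sum>k<K. \<Sum>a<q. \<psi> a * of_real (f (real (a + Suc k * q))))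
        = (\<Sum>k<K. \<Sum>a<q. \<psi> a * of_real (f (real (a + Suc k * q)) - f (real (Suc (Suc k) * q))))"
    proof (rule sum.cong[OF refl])
      fix k
      have "(\<Sum>a<q. \<psi> a * of_real (f (real (a + Suc k * q)) - f (real (Suc (Suc k) * q))))
          = (\<Sum>a<q. \<psi> a * of_real (f (real (a + Suc k * q))))
            - (\<Sum>a<q. \<psi> a) * of_real (f (real (Suc (Suc k) * q)))"
        unfolding of_real_diff right_diff_distrib sum_subtractf sum_distrib_right ..
      thus "(\<Sum>a<q. \<psi> a * of_real (f (real (a + Suc k * q))))
          = (\<Sum>a<q. \<psi> a * of_real (f (real (a + Suc k * q)) - f (real (Suc (Suc k) * q))))"
        unfolding sum_nonprincipal_character[OF psi q] mult_zero_left diff_zero by (rule sym)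
    qed
    also have "\<dots> = (\<Sum>a<q. \<psi> a * of_real (\<Sum>k<K. f (real (a + Suc k * q)) - f (real (Suc (Suc k) * q))))"
      by (subst sum.swap) (simp only: of_real_sum sum_distrib_left)
    also have "(\<Sum>a<q. \<psi> a * of_real (f (real a))) + \<dots>
        = (\<Sum>a<q. \<psi> a * of_real (f (real a)
          + (\<Sum>k<K. f (real (a + Suc k * q)) - f (real (Suc (Suc k) * q)))))"
      unfolding sum.distrib[symmetric] by (intro sum.cong refl) (simp only: of_real_add distrib_left)
    finally show ?thesis .
  qed
  have lim: "(\<lambda>K. \<Sum>k<K. f (real (a + Suc k * q)) - f (real (Suc (Suc k) * q))) \<longlonglongrightarrow> tail_weight q f a"
    if "a \<in> {..<q}" for a
    unfolding tail_weight_def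
    by (rule summable_LIMSEQ[OF tail_weight(1)[OF anti nonneg]]) (use that in auto)
  show ?thesis unfolding eq
    by (rule tendsto_sum, rule tendsto_mult[OF tendsto_const], rule tendsto_of_real,
        rule tendsto_add[OF tendsto_const], rule lim)
qed

section \<open>Character-independent coefficients attached to residue classes\<close>

definition L_coeff :: "nat \<Rightarrow> real \<Rightarrow> nat \<Rightarrow> real" where
  "L_coeff q \<sigma> a = real a powr -\<sigma> + tail_weight q (\<lambda>x. x powr -\<sigma>) a"

definition dL_coeff :: "nat \<Rightarrow> real \<Rightarrow> nat \<Rightarrow> real" where
  "dL_coeff q \<sigma> a = ln (real a) * real a powr -\<sigma> + tail_weight q (\<lambda>x. ln x * x powr -\<sigma>) a"

lemma antimono_powr_neg: "q > 0 \<Longrightarrow> \<sigma> > 0 \<Longrightarrow> antimono_on {real q..} (\<lambda>x. x powr -\<sigma>)"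
  by (intro monotone_onI) (auto intro!: powr_mono2')

text \<open>The derivative is nonpositive once \<open>\<sigma> * ln t \<ge> 1\<close>; for
  \<open>\<sigma> \<ge> 1 / 2\<close> it suffices that \<open>t \<ge> exp 2\<close>, and
  \<open>exp 2 \<le> 8\<close> explains the bound on \<open>q\<close>.\<close>

lemma antimono_ln_powr_neg:
  assumes "q \<ge> 8" "\<sigma> \<ge> 1 / 2"
  shows "antimono_on {real q..} (\<lambda>x. ln x * x powr -\<sigma>)"
proof (intro monotone_onI)
  fix x y assume xy: "x \<in> {real q..}" "y \<in> {real q..}" "x \<le> y"
  have e2: "exp 2 \<le> (8 :: real)"
  proof -
    have "exp (2::real) = exp 1 * exp 1" by (simp flip: exp_add)
    also have "\<dots> \<le> 2.8 * 2.8" using e_less_272 by (intro mult_mono) auto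
    finally show ?thesis by simp
  qed
  show "ln x * x powr -\<sigma> \<ge> ln y * y powr -\<sigma>"
  proof (rule DERIV_nonpos_imp_nonincreasing[OF xy(3)])
    fix t assume t: "x \<le> t" "t \<le> y"
    have t8: "t \<ge> 8" using assms xy t by auto
    have "2 \<le> ln t" using t8 e2 by (subst ln_ge_iff) auto
    hence "1 \<le> \<sigma> * ln t" using assms(2) mult_mono[of "1/2" \<sigma> 2 "ln t"] by simp
    hence "(1 - \<sigma> * ln t) * t powr (-\<sigma> - 1) \<le> 0" by (intro mult_nonpos_nonneg) auto
    moreover have "((\<lambda>x. ln x * x powr -\<sigma>) has_real_derivative (1 - \<sigma> * ln t) * t powr (-\<sigma> - 1)) (at t)"
      using t8 by (auto intro!: derivative_eq_intros simp: field_simps powr_diff)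
    ultimately show "\<exists>z. ((\<lambda>x. ln x * x powr -\<sigma>) has_real_derivative z) (at t) \<and> z \<le> 0" by blast
  qed
qed

lemma L_coeff_bounds:
  assumes "q > 0" "\<sigma> > 0" "a \<le> q"
  shows "L_coeff q \<sigma> a \<ge> real a powr -\<sigma>" "L_coeff q \<sigma> a \<le> real a powr -\<sigma> + real q powr -\<sigma>"
  using tail_weight(2,3)[OF antimono_powr_neg[OF assms(1,2)] _ assms(3)] by (auto simp: L_coeff_def)

lemma dL_coeff_bounds:
  assumes "q \<ge> 8" "\<sigma> \<ge> 1 / 2" "a \<le> q"
  shows "dL_coeff q \<sigma> a \<ge> ln (real a) * real a powr -\<sigma>"
    "dL_coeff q \<sigma> a \<le> ln (real a) * real a powr -\<sigma> + ln (real q) * real q powr -\<sigma>"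
  using tail_weight(2,3)[OF antimono_ln_powr_neg[OF assms(1,2)] _ assms(3)] assms(1)
  by (auto simp: dL_coeff_def)

section \<open>The L-value and its derivative as finite sums\<close>

context
  fixes q :: nat and \<psi> :: "nat \<Rightarrow> complex"
  assumes psi: "\<psi> \<in> nonprincipal_characters q" and q: "q \<ge> 8"
begin

lemma character_0: "\<psi> 0 = 0"
  using psi q by (auto simp: nonprincipal_characters_def dirichlet_character_def)

text \<open>This justifies termwise differentiation of the conditionally convergent series. The
  radius keeps \<open>Re s \<ge> \<sigma> / 2\<close> on the ball, which makes the Abel-summed
  bounds uniform.\<close>

lemma uniform_limit_partial_sums:
  assumes "\<sigma> > 0"
  shows "uniform_limit (ball (of_real \<sigma>) (\<sigma> / 2))
           (\<lambda>n s. \<Sum>k<n. \<psi> (Suc k) / of_nat (Suc k) powr s) (dirichlet_L \<psi>) sequentially"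
proof -
  have q0: "q > 0" using q by simp
  obtain B where "\<forall>n. norm (\<Sum>k<n. \<psi> (Suc k)) \<le> B"
    using bounded_partial_sums_nonprincipal_character[OF psi q0] by blast
  then interpret bounded_partial_sums "\<lambda>k. \<psi> (Suc k)" B by unfold_locales auto
  let ?A = "ball (complex_of_real \<sigma>) (\<sigma> / 2)"
  have A: "Re s \<ge> \<sigma> / 2 \<and> norm s \<le> 2 * \<sigma>" if "s \<in> ?A" for s
  proof -
    have d: "norm (of_real \<sigma> - s) < \<sigma> / 2" using that by (simp add: dist_norm)
    moreover have "Re (of_real \<sigma> - s) \<le> norm (of_real \<sigma> - s)" by (rule complex_Re_le_cmod)
    moreover have "norm s \<le> norm (complex_of_real \<sigma>) + norm (of_real \<sigma> - s)"
      using norm_triangle_ineq4[of "of_real \<sigma>" "of_real \<sigma> - s"] by simp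
    ultimately show ?thesis using assms by simp
  qed
  have s2: "\<sigma> / 2 > 0" using assms by simp
  have "uniform_limit ?A (\<lambda>n s. \<Sum>k<n. T k s) (\<lambda>s. \<Sum>k. T k s) sequentially"
    using norm_T_le[OF s2] A by (intro Weierstrass_m_test[OF _ summable_bound[OF s2, of "2 * \<sigma>"]]) blast
  moreover have "uniform_limit ?A (\<lambda>n s. (\<Sum>k<n. \<psi> (Suc k)) * of_nat (Suc n) powr (-s)) (\<lambda>s. 0) sequentially"
  proof (rule uniform_limitI)
    fix e :: real assume e: "e > 0"
    have "(\<lambda>n. real (Suc n) powr (- (\<sigma> / 2))) \<longlonglongrightarrow> 0"
      using s2 by (intro tendsto_neg_powr filterlim_compose[OF filterlim_real_sequentially]
                      filterlim_Suc) auto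
    hence "(\<lambda>n. B * real (Suc n) powr (- (\<sigma> / 2))) \<longlonglongrightarrow> 0" by (rule tendsto_mult_right_zero)
    hence "\<forall>\<^sub>F n in sequentially. B * real (Suc n) powr (- (\<sigma> / 2)) < e"
      using e by (rule order_tendstoD(2))
    thus "\<forall>\<^sub>F n in sequentially. \<forall>s\<in>?A. dist ((\<Sum>k<n. \<psi> (Suc k)) * of_nat (Suc n) powr (-s)) 0 < e"
    proof eventually_elim
      case (elim n)
      show ?case
      proof
        fix s assume s: "s \<in> ?A"
        have "norm ((\<Sum>k<n. \<psi> (Suc k)) * of_nat (Suc n) powr (-s))
            \<le> B * real (Suc n) powr (- Re s)"
          using mult_right_mono[OF B, of "real (Suc n) powr (- Re s)" n]
          by (simp add: norm_mult norm_powr_Suc del: of_nat_Suc)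
        also have "\<dots> \<le> B * real (Suc n) powr (- (\<sigma> / 2))"
          using A[OF s] B_nonneg by (intro mult_left_mono powr_mono) auto
        finally show "dist ((\<Sum>k<n. \<psi> (Suc k)) * of_nat (Suc n) powr (-s)) 0 < e"
          using elim by simp
      qed
    qed
  qed
  ultimately have "uniform_limit ?A (\<lambda>n s. (\<Sum>k<n. \<psi> (Suc k)) * of_nat (Suc n) powr (-s) + (\<Sum>k<n. T k s))
      (\<lambda>s. 0 + (\<Sum>k. T k s)) sequentially" by (rule uniform_limit_add[rotated])
  moreover have "dirichlet_L \<psi> s = (\<Sum>k. T k s)" if "s \<in> ?A" for s
  proof -
    have "Re s > 0" using A[OF that] s2 by linarith
    thus ?thesis unfolding dirichlet_L_def using series_sums by (simp only: sums_iff)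
  qed
  ultimately show ?thesis unfolding abel_summation add_0
    by (subst uniform_limit_cong'[where g = "\<lambda>n s. (\<Sum>k<n. \<psi> (Suc k)) * of_nat (Suc n) powr (-s) + (\<Sum>k<n. T k s)"
          and i = "\<lambda>s. \<Sum>k. T k s"]) blast+
qed

text \<open>The Dirichlet series starts at 1 and the periods at 0; \<open>\<psi> 0 = 0\<close>
  accounts for the missing term.\<close>

lemma partial_sum_eq:
  "(\<Sum>k<Suc K * q - 1. \<psi> (Suc k) * F (Suc k)) = (\<Sum>n<Suc K * q. \<psi> n * F n)"
proof -
  obtain M where M: "Suc K * q = Suc M" using q by (cases "Suc K * q") auto
  show ?thesis unfolding M by (simp add: sum.lessThan_Suc_shift character_0 del: sum.lessThan_Suc)
qed

lemma filterlim_period: "filterlim (\<lambda>K. Suc K * q - 1) at_top sequentially"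
proof (rule filterlim_at_top_mono[OF filterlim_ident])
  show "\<forall>\<^sub>F K in sequentially. K \<le> Suc K * q - 1"
  proof (intro always_eventually allI)
    fix K
    have "Suc K * 1 \<le> Suc K * q" using q by (intro mult_le_mono) auto
    thus "K \<le> Suc K * q - 1" by simp
  qed
qed

lemma of_nat_powr_of_real: "complex_of_nat n powr of_real x = of_real (real n powr x)"
  using powr_of_real[of "real n" x] by simp

text \<open>The series converges, so its limit may be taken along complete periods, where
  \<open>periodic_sum_limit\<close> evaluates it.\<close>

lemma dirichlet_L_eq:
  assumes "\<sigma> > 0"
  shows "dirichlet_L \<psi> (of_real \<sigma>) = (\<Sum>a<q. of_real (L_coeff q \<sigma> a) * \<psi> a)"
proof -
  have q0: "q > 0" using q by simp
  have "(\<lambda>n. \<Sum>k<n. \<psi> (Suc k) / of_nat (Suc k) powr of_real \<sigma>) \<longlonglongrightarrow> dirichlet_L \<psi> (of_real \<sigma>)"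
    using dirichlet_L_sums[OF psi q0, of "of_real \<sigma>"] assms by (simp add: sums_def)
  hence "(\<lambda>K. \<Sum>k<Suc K * q - 1. \<psi> (Suc k) / of_nat (Suc k) powr of_real \<sigma>)
           \<longlonglongrightarrow> dirichlet_L \<psi> (of_real \<sigma>)"
    by (rule filterlim_compose[OF _ filterlim_period])
  moreover have "\<psi> (Suc k) / of_nat (Suc k) powr of_real \<sigma> = \<psi> (Suc k) * of_real (real (Suc k) powr -\<sigma>)" for k
    unfolding of_nat_powr_of_real by (simp add: powr_minus field_simps del: of_nat_Suc)
  ultimately have "(\<lambda>K. \<Sum>n<Suc K * q. \<psi> n * of_real (real n powr -\<sigma>)) \<longlonglongrightarrow> dirichlet_L \<psi> (of_real \<sigma>)"
    by (simp only: partial_sum_eq[where F = "\<lambda>n. of_real (real n powr -\<sigma>)"])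
  moreover have "(\<lambda>K. \<Sum>n<Suc K * q. \<psi> n * of_real (real n powr -\<sigma>))
        \<longlonglongrightarrow> (\<Sum>a<q. \<psi> a * of_real (L_coeff q \<sigma> a))"
    unfolding L_coeff_def
    by (rule periodic_sum_limit[OF psi q0 antimono_powr_neg[OF q0 assms]]) auto
  ultimately show ?thesis unfolding mult.commute[of "of_real _" "\<psi> _"] by (rule LIMSEQ_unique)
qed

lemma deriv_dirichlet_L_eq:
  assumes "\<sigma> \<ge> 1 / 2"
  shows "- deriv (dirichlet_L \<psi>) (of_real \<sigma>) = (\<Sum>a<q. of_real (dL_coeff q \<sigma> a) * \<psi> a)"
proof -
  have q0: "q > 0" and s0: "\<sigma> > 0" using q assms by auto
  have der: "((\<lambda>s. \<psi> (Suc k) / of_nat (Suc k) powr s) has_field_derivative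
               - (\<psi> (Suc k) * of_real (ln (real (Suc k)) * real (Suc k) powr -\<sigma>))) (at (of_real \<sigma>))" for k
  proof -
    have "((\<lambda>s. of_nat (Suc k) powr (-s)) has_field_derivative
        Ln (of_nat (Suc k)) * of_nat (Suc k) powr (- of_real \<sigma>) * (-1)) (at (of_real \<sigma>))"
      by (rule DERIV_chain2[OF has_field_derivative_powr_right])
         (auto intro!: derivative_eq_intros simp del: of_nat_Suc)
    hence "((\<lambda>s. \<psi> (Suc k) * of_nat (Suc k) powr (-s)) has_field_derivative
        \<psi> (Suc k) * (Ln (of_nat (Suc k)) * of_nat (Suc k) powr (- of_real \<sigma>) * (-1))) (at (of_real \<sigma>))"
      by (rule DERIV_cmult)
    moreover have "\<psi> (Suc k) * (Ln (of_nat (Suc k)) * of_nat (Suc k) powr (- of_real \<sigma>) * (-1))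
        = - (\<psi> (Suc k) * of_real (ln (real (Suc k)) * real (Suc k) powr -\<sigma>))"
      using of_nat_powr_of_real[of "Suc k" "-\<sigma>"] Ln_of_nat[of "Suc k"]
      by (simp del: of_nat_Suc)
    moreover have "(\<lambda>s. \<psi> (Suc k) * of_nat (Suc k) powr (-s)) = (\<lambda>s. \<psi> (Suc k) / of_nat (Suc k) powr s)"
      by (rule ext) (simp add: powr_minus_divide del: of_nat_Suc)
    ultimately show ?thesis by (simp only:)
  qed
  have "(\<lambda>n. deriv (\<lambda>s. \<Sum>k<n. \<psi> (Suc k) / of_nat (Suc k) powr s) (of_real \<sigma>))
          \<longlonglongrightarrow> deriv (dirichlet_L \<psi>) (of_real \<sigma>)"
    using s0
    by (intro deriv_complex_uniform_limit[OF uniform_limit_partial_sums[OF s0]])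
       (auto intro!: always_eventually holomorphic_intros simp del: of_nat_Suc)
  moreover have "deriv (\<lambda>s. \<Sum>k<n. \<psi> (Suc k) / of_nat (Suc k) powr s) (of_real \<sigma>)
      = - (\<Sum>k<n. \<psi> (Suc k) * of_real (ln (real (Suc k)) * real (Suc k) powr -\<sigma>))" for n
    by (rule DERIV_imp_deriv) (use DERIV_sum[OF der, where S = "{..<n}"] in \<open>simp add: sum_negf del: of_nat_Suc\<close>)
  ultimately have "(\<lambda>n. - (\<Sum>k<n. \<psi> (Suc k) * of_real (ln (real (Suc k)) * real (Suc k) powr -\<sigma>)))
          \<longlonglongrightarrow> deriv (dirichlet_L \<psi>) (of_real \<sigma>)"
    by (simp only:)
  hence "(\<lambda>n. \<Sum>k<n. \<psi> (Suc k) * of_real (ln (real (Suc k)) * real (Suc k) powr -\<sigma>))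
          \<longlonglongrightarrow> - deriv (dirichlet_L \<psi>) (of_real \<sigma>)"
    by (drule_tac tendsto_minus) (simp only: minus_minus)
  hence "(\<lambda>K. \<Sum>k<Suc K * q - 1. \<psi> (Suc k) * of_real (ln (real (Suc k)) * real (Suc k) powr -\<sigma>))
          \<longlonglongrightarrow> - deriv (dirichlet_L \<psi>) (of_real \<sigma>)"
    by (rule filterlim_compose[OF _ filterlim_period])
  hence "(\<lambda>K. \<Sum>n<Suc K * q. \<psi> n * of_real (ln (real n) * real n powr -\<sigma>))
          \<longlonglongrightarrow> - deriv (dirichlet_L \<psi>) (of_real \<sigma>)"
    by (simp only: partial_sum_eq[where F = "\<lambda>n. of_real (ln (real n) * real n powr -\<sigma>)"])
  moreover have "(\<lambda>K. \<Sum>n<Suc K * q. \<psi> n * of_real (ln (real n) * real n powr -\<sigma>))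
        \<longlonglongrightarrow> (\<Sum>a<q. \<psi> a * of_real (dL_coeff q \<sigma> a))"
    unfolding dL_coeff_def
    by (rule periodic_sum_limit[OF psi q0 antimono_ln_powr_neg[OF q assms]]) (use q in auto)
  ultimately show ?thesis unfolding mult.commute[of "of_real _" "\<psi> _"] by (rule LIMSEQ_unique)
qed

end

section \<open>The resonance inequality\<close>

lemma sum_powr_neg_le:
  assumes "\<sigma> \<le> 1" "q > 0"
  shows "(\<Sum>a<q. real a powr -\<sigma>) \<le> real q powr (1 - \<sigma>) * (ln (real q) + 1)"
proof -
  \<comment> \<open>The term \<open>a = 0\<close> vanishes because
    \<open>0 powr x = 0\<close>.\<close>
  have "(\<Sum>a<q. real a powr -\<sigma>) = (\<Sum>a\<in>{1..<q}. real a powr -\<sigma>)"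
    by (intro sum.mono_neutral_right) (auto simp: Suc_le_eq)
  also have "\<dots> \<le> (\<Sum>a\<in>{1..<q}. real q powr (1 - \<sigma>) * inverse (real a))"
  proof (rule sum_mono)
    fix a assume a: "a \<in> {1..<q}"
    have "real a powr -\<sigma> = real a powr (1 - \<sigma>) * inverse (real a)"
      using a by (simp add: powr_diff powr_minus field_simps)
    also have "\<dots> \<le> real q powr (1 - \<sigma>) * inverse (real a)"
      using a assms by (intro mult_right_mono powr_mono2) auto
    finally show "real a powr -\<sigma> \<le> real q powr (1 - \<sigma>) * inverse (real a)" .
  qed
  also have "\<dots> \<le> real q powr (1 - \<sigma>) * (\<Sum>a=1..q. inverse (real a))"
    unfolding sum_distrib_left[symmetric] by (intro mult_left_mono sum_mono2) auto
  also have "(\<Sum>a=1..q. inverse (real a)) = harm q" by (simp add: harm_def)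
  also have "real q powr (1 - \<sigma>) * harm q \<le> real q powr (1 - \<sigma>) * (ln (real q) + 1)"
    using decseqD[OF decseq_harm_diff_ln, of 0 "q - 1"] assms(2)
    by (intro mult_left_mono) (auto simp: harm_def)
  finally show ?thesis .
qed

lemma sum_L_coeff_le:
  assumes "q \<ge> 8" "0 < \<sigma>" "\<sigma> \<le> 1"
  shows "(\<Sum>a<q. L_coeff q \<sigma> a) \<le> real q powr (1 - \<sigma>) * (ln (real q) + 2)"
proof -
  have "(\<Sum>a<q. L_coeff q \<sigma> a) \<le> (\<Sum>a<q. real a powr -\<sigma> + real q powr -\<sigma>)"
    using assms by (intro sum_mono L_coeff_bounds) auto
  also have "\<dots> = (\<Sum>a<q. real a powr -\<sigma>) + real q powr (1 - \<sigma>)"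
    using assms powr_add[of "real q" 1 "-\<sigma>"] by (simp add: sum.distrib)
  finally show ?thesis using sum_powr_neg_le[of \<sigma> q] assms by (simp add: algebra_simps)
qed

lemma sum_dL_coeff_le:
  assumes "q \<ge> 8" "1 / 2 \<le> \<sigma>" "\<sigma> \<le> 1"
  shows "(\<Sum>a<q. dL_coeff q \<sigma> a) \<le> ln (real q) * (real q powr (1 - \<sigma>) * (ln (real q) + 2))"
proof -
  have "(\<Sum>a<q. dL_coeff q \<sigma> a)
      \<le> (\<Sum>a<q. ln (real q) * (real a powr -\<sigma> + real q powr -\<sigma>))"
  proof (rule sum_mono)
    fix a assume a: "a \<in> {..<q}"
    have "ln (real a) * real a powr -\<sigma> \<le> ln (real q) * real a powr -\<sigma>"
      using a by (cases "a = 0") (auto intro!: mult_right_mono)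
    thus "dL_coeff q \<sigma> a \<le> ln (real q) * (real a powr -\<sigma> + real q powr -\<sigma>)"
      using dL_coeff_bounds(2)[of q \<sigma> a] assms a by (simp add: algebra_simps)
  qed
  also have "\<dots> = ln (real q) * ((\<Sum>a<q. real a powr -\<sigma>) + real q powr (1 - \<sigma>))"
    using assms powr_add[of "real q" 1 "-\<sigma>"] by (simp add: sum.distrib flip: sum_distrib_left)
  also have "\<dots> \<le> ln (real q) * (real q powr (1 - \<sigma>) * (ln (real q) + 2))"
    using sum_powr_neg_le[of \<sigma> q] assms by (intro mult_left_mono) (auto simp: algebra_simps)
  finally show ?thesis .
qed

lemma L_coeff_nonneg: "q > 0 \<Longrightarrow> \<sigma> > 0 \<Longrightarrow> a \<le> q \<Longrightarrow> L_coeff q \<sigma> a \<ge> 0"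
  using L_coeff_bounds(1)[of q \<sigma> a] powr_ge_zero[of "real a" "-\<sigma>"] by linarith

lemma dL_coeff_nonneg:
  assumes "q \<ge> 8" "1 / 2 \<le> \<sigma>" "a \<le> q"
  shows "dL_coeff q \<sigma> a \<ge> 0"
proof -
  have "ln (real a) * real a powr -\<sigma> \<ge> 0" by (cases "a = 0") auto
  thus ?thesis using dL_coeff_bounds(1)[OF assms] by linarith
qed

text \<open>Either the sum is 0 or the character is principal and
  \<open>\<psi> d = 1\<close>.\<close>

lemma sum_dirichlet_character_shift:
  assumes "dirichlet_character q \<psi>" "q > 0" "coprime d q"
  shows "\<psi> d * (\<Sum>a<q. \<psi> a) = (\<Sum>a<q. \<psi> a)"
proof (cases "\<psi> \<in> nonprincipal_characters q")
  case True
  thus ?thesis using sum_nonprincipal_character[OF True assms(2)] by simp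
next
  case False
  thus ?thesis using assms by (auto simp: nonprincipal_characters_def principal_character_def)
qed

lemma sum_multiples:
  fixes G :: "nat \<Rightarrow> 'a :: comm_monoid_add"
  assumes "d > 0"
  shows "(\<Sum>a | a < q \<and> d * a < q. G (d * a)) = (\<Sum>c | c < q \<and> d dvd c. G c)"
proof (rule sum.reindex_bij_witness[where i = "\<lambda>c. c div d" and j = "\<lambda>a. d * a"])
  fix c assume c: "c \<in> {c. c < q \<and> d dvd c}"
  thus "c div d \<in> {a. a < q \<and> d * a < q}"
    by (auto intro: le_less_trans[OF div_le_dividend])
qed (use assms in auto)

section \<open>The resonance argument for characters modulo a prime\<close>

context
  fixes q g :: nat and \<sigma> :: real
  assumes q: "prime q" and g: "residue_primroot q g" and q8: "q \<ge> 8"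
    and \<sigma>: "1 / 2 \<le> \<sigma>" "\<sigma> < 1"
begin

interpretation character_family "q - 1" "power_character q g"
  by (rule character_family_power_character[OF q g])

text \<open>An L-value for \<open>0 < j < q - 1\<close>. At \<open>j = 0\<close> it is merely the
  same finite sum, which lets orthogonality run over the whole family.\<close>

definition L_val :: "nat \<Rightarrow> complex" where
  "L_val j = (\<Sum>a<q. of_real (L_coeff q \<sigma> a) * power_character q g j a)"

definition dL_val :: "nat \<Rightarrow> complex" where
  "dL_val j = (\<Sum>a<q. of_real (dL_coeff q \<sigma> a) * power_character q g j a)"

text \<open>It vanishes for \<open>0 < j < q - 1\<close>, so adding a multiple of it alters only the
  term of the principal character.\<close>

definition char_sum :: "nat \<Rightarrow> complex" where
  "char_sum j = (\<Sum>a<q. power_character q g j a)"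

lemma norm_power_character_le: "norm (power_character q g j a) \<le> 1"
  by (simp add: power_character_def)

lemma norm_L_val_le: "norm (L_val j) \<le> real q powr (1 - \<sigma>) * (ln (real q) + 2)"
proof -
  have "norm (L_val j) \<le> (\<Sum>a<q. norm (of_real (L_coeff q \<sigma> a) * power_character q g j a))"
    unfolding L_val_def by (rule norm_sum)
  also have "\<dots> \<le> (\<Sum>a<q. L_coeff q \<sigma> a)"
  proof (rule sum_mono)
    fix a assume "a \<in> {..<q}"
    thus "norm (of_real (L_coeff q \<sigma> a) * power_character q g j a) \<le> L_coeff q \<sigma> a"
      using L_coeff_nonneg[of q \<sigma> a] q8 \<sigma> norm_power_character_le
      by (simp add: norm_mult mult_left_le)
  qed
  finally show ?thesis using sum_L_coeff_le[OF q8, of \<sigma>] \<sigma> by simp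
qed

lemma norm_dL_val_le:
  "norm (dL_val j) \<le> ln (real q) * (real q powr (1 - \<sigma>) * (ln (real q) + 2))"
proof -
  have "norm (dL_val j) \<le> (\<Sum>a<q. norm (of_real (dL_coeff q \<sigma> a) * power_character q g j a))"
    unfolding dL_val_def by (rule norm_sum)
  also have "\<dots> \<le> (\<Sum>a<q. dL_coeff q \<sigma> a)"
  proof (rule sum_mono)
    fix a assume "a \<in> {..<q}"
    thus "norm (of_real (dL_coeff q \<sigma> a) * power_character q g j a) \<le> dL_coeff q \<sigma> a"
      using dL_coeff_nonneg[of q \<sigma> a] q8 \<sigma> norm_power_character_le
      by (simp add: norm_mult mult_left_le)
  qed
  finally show ?thesis using sum_dL_coeff_le[OF q8, of \<sigma>] \<sigma> by simp
qed

lemma norm_char_sum_le: "norm (char_sum j) \<le> real q"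
  using sum_norm_le[of "{..<q}" "power_character q g j" "\<lambda>_. 1"] norm_power_character_le
  by (simp add: char_sum_def)

lemma pos_L_val: "pos L_val"
  unfolding L_val_def[abs_def] using q8 \<sigma> by (intro pos_sum pos_monom L_coeff_nonneg) auto

text \<open>The coefficient at \<open>a = 1\<close> is at least \<open>1 powr -\<sigma> = 1\<close>
  and absorbs the constant.\<close>

lemma pos_L_val_minus_1: "pos (\<lambda>j. L_val j - 1)"
proof -
  have "L_val j - 1 = (\<Sum>a<q. of_real (L_coeff q \<sigma> a - (if a = 1 then 1 else 0)) * power_character q g j a)" for j
  proof -
    have "(\<Sum>a<q. of_real (if a = 1 then 1 else 0) * power_character q g j a) = power_character q g j 1"
      using q8 by (subst sum.mono_neutral_right[of _ "{1}"]) auto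
    thus ?thesis unfolding L_val_def of_real_diff left_diff_distrib sum_subtractf chi_1 by simp
  qed
  moreover have "L_coeff q \<sigma> a - (if a = 1 then 1 else 0) \<ge> 0" if "a < q" for a
    using L_coeff_bounds(1)[of q \<sigma> a] L_coeff_nonneg[of q \<sigma> a] that q8 \<sigma> by auto
  ultimately show ?thesis by (simp only:) (intro pos_sum pos_monom, auto)
qed

text \<open>The convolution of \<open>mangoldt\<close> with the constant \<open>1\<close> is \<open>ln\<close>, so the coefficients of
  \<open>- L' - P L\<close> are nonnegative up to an error which is the same for all residue classes and
  hence invisible to the nonprincipal characters.\<close>
lemma pos_dL_val_minus:
  assumes Y: "Y < q"
  shows "pos (\<lambda>j. dL_val j + of_real (2 * real q powr -\<sigma> * chebyshev_psi Y) * char_sum j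
           - (\<Sum>d=1..Y. of_real (mangoldt d * real d powr -\<sigma>) * power_character q g j d) * L_val j)"
proof -
  let ?ch = "power_character q g"
  \<comment> \<open>The excess of a coefficient of \<open>P L\<close> over the exact convolution
    term, which is kept only while \<open>d * a\<close> stays below \<open>q\<close>.\<close>
  define r where "r d a = real d powr -\<sigma> * L_coeff q \<sigma> a
                     - (if d * a < q then real (d * a) powr -\<sigma> else 0)" for d a
  define D where "D c = dL_coeff q \<sigma> c - real c powr -\<sigma> * (\<Sum>d | d \<in> {1..Y} \<and> d dvd c. mangoldt d)" for c
  \<comment> \<open>One \<open>q powr -\<sigma>\<close> comes from the tail in
    \<open>L_coeff\<close>, the other from a product \<open>d * a \<ge> q\<close>.\<close>
  have r: "r d a \<le> 2 * real q powr -\<sigma>" if d: "d \<in> {1..Y}" and a: "a < q" for d a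
  proof -
    have d1: "real d powr -\<sigma> \<le> 1" using d \<sigma> powr_mono2'[of "-\<sigma>" 1 "real d"] by simp
    have b: "L_coeff q \<sigma> a \<le> real a powr -\<sigma> + real q powr -\<sigma>"
      using L_coeff_bounds(2)[of q \<sigma> a] q8 \<sigma> a by simp
    have "real d powr -\<sigma> * L_coeff q \<sigma> a \<le> real d powr -\<sigma> * (real a powr -\<sigma> + real q powr -\<sigma>)"
      by (intro mult_left_mono b) auto
    also have "\<dots> \<le> real (d * a) powr -\<sigma> + 1 * real q powr -\<sigma>"
      unfolding distrib_left using d1 by (intro add_mono mult_right_mono) (auto simp: powr_mult)
    finally have *: "real d powr -\<sigma> * L_coeff q \<sigma> a \<le> real (d * a) powr -\<sigma> + real q powr -\<sigma>" by simp
    show ?thesis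
    proof (cases "d * a < q")
      case False
      hence "real (d * a) powr -\<sigma> \<le> real q powr -\<sigma>"
        using \<sigma> q8 by (intro powr_mono2') (auto simp flip: of_nat_mult)
      thus ?thesis using * False by (simp add: r_def)
    next
      case True
      have "real q powr -\<sigma> \<ge> 0" by simp
      thus ?thesis using * True unfolding r_def by (simp del: powr_ge_zero of_nat_mult)
    qed
  qed
  have Dnonneg: "D c \<ge> 0" if c: "c < q" for c
  proof (cases "c = 0")
    case True
    thus ?thesis using dL_coeff_nonneg[of q \<sigma> 0] q8 \<sigma> by (simp add: D_def)
  next
    case False
    have "(\<Sum>d | d \<in> {1..Y} \<and> d dvd c. mangoldt d) \<le> (\<Sum>d | d dvd c. mangoldt d :: real)"
      using False by (intro sum_mono2) (auto simp: mangoldt_nonneg)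
    also have "\<dots> = ln (real c)" using mangoldt_sum[OF False, where ?'a = real] by simp
    finally have "real c powr -\<sigma> * (\<Sum>d | d \<in> {1..Y} \<and> d dvd c. mangoldt d) \<le> real c powr -\<sigma> * ln (real c)"
      by (intro mult_left_mono) auto
    thus ?thesis using dL_coeff_bounds(1)[of q \<sigma> c] q8 \<sigma> c by (simp add: D_def mult.commute)
  qed
  have multiples: "(\<Sum>d=1..Y. \<Sum>a<q. of_real (mangoldt d * (if d * a < q then real (d * a) powr -\<sigma> else 0)) * ?ch j (d * a))
      = (\<Sum>c<q. of_real (real c powr -\<sigma> * (\<Sum>d | d \<in> {1..Y} \<and> d dvd c. mangoldt d)) * ?ch j c)" for j
  proof -
    have "(\<Sum>a<q. of_real (mangoldt d * (if d * a < q then real (d * a) powr -\<sigma> else 0)) * ?ch j (d * a))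
        = (\<Sum>c<q. if d dvd c then of_real (mangoldt d * real c powr -\<sigma>) * ?ch j c else 0)"
      if "d \<in> {1..Y}" for d
    proof -
      let ?G = "\<lambda>c. of_real (mangoldt d * real c powr -\<sigma>) * ?ch j c"
      have "(\<Sum>a<q. of_real (mangoldt d * (if d * a < q then real (d * a) powr -\<sigma> else 0)) * ?ch j (d * a))
          = (\<Sum>a | a < q \<and> d * a < q. ?G (d * a))"
        by (intro sum.mono_neutral_cong_right) auto
      also have "\<dots> = (\<Sum>c | c < q \<and> d dvd c. ?G c)" using that by (intro sum_multiples) auto
      also have "\<dots> = (\<Sum>c<q. if d dvd c then ?G c else 0)"
        by (intro sum.mono_neutral_cong_left) auto
      finally show ?thesis .
    qed
    hence "(\<Sum>d=1..Y. \<Sum>a<q. of_real (mangoldt d * (if d * a < q then real (d * a) powr -\<sigma> else 0)) * ?ch j (d * a))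
        = (\<Sum>d=1..Y. \<Sum>c<q. if d dvd c then of_real (mangoldt d * real c powr -\<sigma>) * ?ch j c else 0)"
      by (rule sum.cong[OF refl])
    also have "\<dots> = (\<Sum>c<q. \<Sum>d=1..Y. if d dvd c then of_real (mangoldt d * real c powr -\<sigma>) * ?ch j c else 0)"
      by (rule sum.swap)
    also have "\<dots> = (\<Sum>c<q. \<Sum>d | d \<in> {1..Y} \<and> d dvd c. of_real (mangoldt d * real c powr -\<sigma>) * ?ch j c)"
      by (rule sum.cong[OF refl], rule sum.mono_neutral_cong_right) auto
    finally show ?thesis
      by (simp only: of_real_mult of_real_sum sum_distrib_left sum_distrib_right mult_ac)
  qed
  \<comment> \<open>Multiplication by \<open>d\<close> permutes the invertible residues, so a weight
    independent of \<open>a\<close> collapses to \<open>char_sum\<close>.\<close>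
  have shift: "(\<Sum>a<q. ?ch j (d * a)) = char_sum j" if d: "d \<in> {1..Y}" for j d
  proof -
    have "\<not> q dvd d" using d Y by (auto dest: dvd_imp_le)
    hence "coprime d q" by (simp add: coprime_iff[OF q g])
    thus ?thesis
      using sum_dirichlet_character_shift[OF dirichlet_power_character[OF q g, of j] _ \<open>coprime d q\<close>] q8
      by (simp add: chi_mult char_sum_def flip: sum_distrib_left)
  qed
  \<comment> \<open>Replacing \<open>r\<close> by its complement to the common bound makes all
    coefficients nonnegative, at the price of the multiple of \<open>char_sum\<close>.\<close>
  have "dL_val j + of_real (2 * real q powr -\<sigma> * chebyshev_psi Y) * char_sum j
           - (\<Sum>d=1..Y. of_real (mangoldt d * real d powr -\<sigma>) * ?ch j d) * L_val j
      = (\<Sum>c<q. of_real (D c) * ?ch j c)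
          + (\<Sum>d=1..Y. \<Sum>a<q. of_real (mangoldt d * (2 * real q powr -\<sigma> - r d a)) * ?ch j (d * a))" for j
  proof -
    have 1: "(\<Sum>d=1..Y. of_real (mangoldt d * real d powr -\<sigma>) * ?ch j d) * L_val j
        = (\<Sum>d=1..Y. \<Sum>a<q. of_real (mangoldt d * (real d powr -\<sigma> * L_coeff q \<sigma> a)) * ?ch j (d * a))"
      unfolding L_val_def sum_product by (simp add: chi_mult mult_ac)
    have 2: "(\<Sum>d=1..Y. \<Sum>a<q. of_real (mangoldt d * (real d powr -\<sigma> * L_coeff q \<sigma> a)) * ?ch j (d * a))
        = (\<Sum>d=1..Y. \<Sum>a<q. of_real (mangoldt d * (if d * a < q then real (d * a) powr -\<sigma> else 0)) * ?ch j (d * a))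
        + (\<Sum>d=1..Y. \<Sum>a<q. of_real (mangoldt d * r d a) * ?ch j (d * a))"
      unfolding sum.distrib[symmetric] distrib_right[symmetric] of_real_add[symmetric] distrib_left[symmetric]
      by (simp add: r_def)
    have 3: "of_real (2 * real q powr -\<sigma> * chebyshev_psi Y) * char_sum j
        = (\<Sum>d=1..Y. \<Sum>a<q. of_real (mangoldt d * (2 * real q powr -\<sigma>)) * ?ch j (d * a))"
    proof -
      have "(\<Sum>d=1..Y. \<Sum>a<q. of_real (mangoldt d * (2 * real q powr -\<sigma>)) * ?ch j (d * a))
          = (\<Sum>d=1..Y. of_real (mangoldt d * (2 * real q powr -\<sigma>)) * char_sum j)"
        by (rule sum.cong[OF refl]) (simp only: sum_distrib_left[symmetric] shift)
      thus ?thesis unfolding chebyshev_psi_def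
        by (simp only: of_real_mult of_real_sum sum_distrib_left sum_distrib_right mult_ac)
    qed
    have 4: "(\<Sum>c<q. of_real (D c) * ?ch j c) = dL_val j
        - (\<Sum>c<q. of_real (real c powr -\<sigma> * (\<Sum>d | d \<in> {1..Y} \<and> d dvd c. mangoldt d)) * ?ch j c)"
      unfolding D_def dL_val_def of_real_diff left_diff_distrib sum_subtractf ..
    have 5: "(\<Sum>d=1..Y. \<Sum>a<q. of_real (mangoldt d * (2 * real q powr -\<sigma> - r d a)) * ?ch j (d * a))
        = (\<Sum>d=1..Y. \<Sum>a<q. of_real (mangoldt d * (2 * real q powr -\<sigma>)) * ?ch j (d * a))
        - (\<Sum>d=1..Y. \<Sum>a<q. of_real (mangoldt d * r d a) * ?ch j (d * a))"
      unfolding right_diff_distrib of_real_diff left_diff_distrib sum_subtractf ..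
    show ?thesis unfolding 1 2 3 4 5 multiples by (rule add_diff_add)
  qed
  moreover have "pos (\<lambda>j. (\<Sum>c<q. of_real (D c) * ?ch j c)
          + (\<Sum>d=1..Y. \<Sum>a<q. of_real (mangoldt d * (2 * real q powr -\<sigma> - r d a)) * ?ch j (d * a)))"
    using Dnonneg r by (intro pos_add pos_sum pos_monom mult_nonneg_nonneg mangoldt_nonneg) auto
  ultimately show ?thesis by (simp only:)
qed

lemma L_val_eq:
  assumes "0 < j" "j < q - 1"
  shows "dirichlet_L (power_character q g j) (of_real \<sigma>) = L_val j"
    "- deriv (dirichlet_L (power_character q g j)) (of_real \<sigma>) = dL_val j"
    "char_sum j = 0"
proof -
  note np = nonprincipal_power_character[OF q g assms]
  show "dirichlet_L (power_character q g j) (of_real \<sigma>) = L_val j"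
    unfolding L_val_def by (rule dirichlet_L_eq[OF np q8]) (use \<sigma> in simp)
  show "- deriv (dirichlet_L (power_character q g j)) (of_real \<sigma>) = dL_val j"
    unfolding dL_val_def by (rule deriv_dirichlet_L_eq[OF np q8 \<sigma>(1)])
  show "char_sum j = 0"
    unfolding char_sum_def by (rule sum_nonprincipal_character[OF np]) (use q8 in simp)
qed

text \<open>At the principal character every factor is \<open>1 / (1 - lam)\<close>, and there are
  at most \<open>Y\<close> primes up to \<open>Y\<close>.\<close>

lemma norm_resonator_0_le:
  assumes "0 \<le> lam" "lam < 1" "\<And>p. p \<in> B \<Longrightarrow> prime p \<and> p \<le> Y" "Y < q"
  shows "norm (resonator lam B 0) \<le> (1 / (1 - lam)) ^ Y"
proof -
  have sub: "B \<subseteq> {1..Y}" using assms(3) prime_ge_1_nat by fastforce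
  have "euler_factor lam p 0 = of_real (1 / (1 - lam))" if "p \<in> B" for p
  proof -
    have "\<not> q dvd p" using assms(3)[OF that] assms(4) prime_gt_0_nat by (auto dest: dvd_imp_le)
    thus ?thesis by (simp add: euler_factor_def power_character_0[OF q g] del: One_nat_def)
  qed
  hence "resonator lam B 0 = of_real (1 / (1 - lam)) ^ card B"
    unfolding resonator_def[OF assms(1,2)] by (simp only: prod_constant cong: prod.cong)
  hence "norm (resonator lam B 0) = \<bar>1 / (1 - lam)\<bar> ^ card B"
    by (simp only: norm_power norm_of_real)
  also have "\<bar>1 / (1 - lam)\<bar> = 1 / (1 - lam)" using assms(2) by simp
  also have "(1 / (1 - lam)) ^ card B \<le> (1 / (1 - lam)) ^ Y"
    using card_mono[OF _ sub] assms(1,2) by (intro power_increasing) auto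
  finally show ?thesis .
qed

text \<open>\<open>resonance\<close> is applied to the coefficients of \<open>P\<close>. The last
  summand is the term of the principal character divided by the total weight, which is at least
  \<open>q - 1\<close>.\<close>

lemma weighted_mangoldt_sum_le:
  assumes lam: "0 \<le> lam" "lam < 1" and Y: "Y < q" and V: "V \<ge> 0"
    and mu: "\<And>p k. prime p \<Longrightarrow> p ^ k \<le> Y \<Longrightarrow> mu \<le> lam ^ k"
    and le: "\<And>\<psi>. \<psi> \<in> nonprincipal_characters q \<Longrightarrow> - Re (log_deriv_L \<psi> (of_real \<sigma>)) \<le> V"
  shows "mu * (\<Sum>d=1..Y. mangoldt d * real d powr -\<sigma>)
     \<le> V + (1 / (1 - lam)) ^ (2 * Y) * real q powr (2 * (1 - \<sigma>)) * (ln (real q) + 2)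
            * (ln (real q) * (ln (real q) + 2) + 8 * real Y) / real (q - 1)"
proof -
  let ?ch = "power_character q g"
  define B where "B = {p. prime p \<and> p \<le> Y}"
  define R where "R = resonator lam B"
  define e where "e = 2 * real q powr -\<sigma> * chebyshev_psi Y"
  define m where "m j = dL_val j + of_real e * char_sum j" for j
  define W where "W = (\<Sum>j<q-1. norm (R j * L_val j) ^ 2)"
  define X where "X = ln (real q)"
  have finB: "finite B" unfolding B_def by (rule finite_subset[of _ "{..Y}"]) auto
  have unitB: "unit p" if "p \<in> B" for p
  proof -
    have "\<not> q dvd p" using that Y prime_gt_0_nat by (auto simp: B_def dest: dvd_imp_le)
    thus ?thesis unfolding unit_def using power_character_unit[OF q g] N_pos by blast
  qed
  have W: "W \<ge> real (q - 1)"
    unfolding W_def R_def by (rule resonator_weight_ge[OF lam unitB pos_L_val_minus_1])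
  have N0: "real (q - 1) > 0" using q8 by simp
  have "mu * (\<Sum>d=1..Y. mangoldt d * real d powr -\<sigma>) * W
          \<le> (\<Sum>j<q-1. norm (R j) ^ 2 * Re (m j * cnj (L_val j)))"
    unfolding W_def R_def
  proof (rule resonance[OF lam finB unitB _ pos_L_val])
    show "pos (\<lambda>j. m j - (\<Sum>d=1..Y. of_real (mangoldt d * real d powr -\<sigma>) * ?ch j d) * L_val j)"
      unfolding m_def e_def by (rule pos_dL_val_minus[OF Y])
    fix d assume d: "d \<in> {1..Y}"
    show "0 \<le> mangoldt d * real d powr - \<sigma> \<and>
         (0 < mangoldt d * real d powr - \<sigma> \<longrightarrow> (\<exists>p\<in>B. \<exists>k. d = p ^ k \<and> mu \<le> lam ^ k))"
    proof (intro conjI impI)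
      show "0 \<le> mangoldt d * real d powr - \<sigma>" by (simp add: mangoldt_nonneg)
      assume "0 < mangoldt d * real d powr - \<sigma>"
      hence "primepow d" by (auto simp: mangoldt_def split: if_splits)
      then obtain p k where p: "prime p" "k > 0" "d = p ^ k" by (auto simp: primepow_def)
      have "p \<le> p ^ k" using p by (intro self_le_power prime_ge_1_nat)
      hence "p \<in> B" using p d by (auto simp: B_def)
      thus "\<exists>p\<in>B. \<exists>k. d = p ^ k \<and> mu \<le> lam ^ k" using p d mu[of p k] by auto
    qed
  qed
  \<comment> \<open>The assumed bound says nothing about index 0, so that term is split off and
    estimated trivially.\<close>
  also have "\<dots> = norm (R 0) ^ 2 * Re (m 0 * cnj (L_val 0))
                  + (\<Sum>j\<in>{1..<q-1}. norm (R j) ^ 2 * Re (m j * cnj (L_val j)))"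
    using q8 by (subst sum.atLeast_Suc_lessThan[symmetric, of 0, unfolded One_nat_def[symmetric]])
                (auto simp: atLeast0LessThan)
  also have "(\<Sum>j\<in>{1..<q-1}. norm (R j) ^ 2 * Re (m j * cnj (L_val j)))
      \<le> (\<Sum>j\<in>{1..<q-1}. V * norm (R j * L_val j) ^ 2)"
  proof (rule sum_mono)
    fix j assume j: "j \<in> {1..<q-1}"
    hence j': "0 < j" "j < q - 1" by auto
    \<comment> \<open>Away from zeros of \<open>L\<close> this is the assumed bound times
      \<open>|L|^2\<close>; at a zero both sides are 0.\<close>
    have "Re (m j * cnj (L_val j)) \<le> V * norm (L_val j) ^ 2"
    proof (cases "L_val j = 0")
      case False
      have "- Re (log_deriv_L (?ch j) (of_real \<sigma>)) = Re (m j / L_val j)"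
        unfolding log_deriv_L_def m_def L_val_eq(1)[OF j'] L_val_eq(3)[OF j'] L_val_eq(2)[OF j', symmetric]
        by simp
      also have "\<dots> = Re (m j * cnj (L_val j)) / norm (L_val j) ^ 2"
        by (subst complex_div_cnj) (simp flip: of_real_power)
      finally show ?thesis
        using le[OF nonprincipal_power_character[OF q g j']] False by (simp add: divide_le_eq)
    qed simp
    hence "norm (R j) ^ 2 * Re (m j * cnj (L_val j)) \<le> norm (R j) ^ 2 * (V * norm (L_val j) ^ 2)"
      by (intro mult_left_mono) auto
    thus "norm (R j) ^ 2 * Re (m j * cnj (L_val j)) \<le> V * norm (R j * L_val j) ^ 2"
      by (simp add: norm_mult power_mult_distrib mult_ac)
  qed
  \<comment> \<open>Since \<open>V \<ge> 0\<close>, index 0 may be put back into the sum.\<close>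
  also have "\<dots> \<le> V * W"
    unfolding W_def sum_distrib_left[symmetric] using V by (intro mult_left_mono sum_mono2) auto
  also have "norm (R 0) ^ 2 * Re (m 0 * cnj (L_val 0))
      \<le> (1 / (1 - lam)) ^ (2 * Y) * real q powr (2 * (1 - \<sigma>)) * (X + 2) * (X * (X + 2) + 8 * real Y)"
  proof -
    define Q where "Q = real q powr (1 - \<sigma>)"
    have X0: "X \<ge> 0" using q8 by (simp add: X_def)
    have "norm (R 0) \<le> (1 / (1 - lam)) ^ Y"
      unfolding R_def using Y by (intro norm_resonator_0_le lam) (auto simp: B_def)
    hence R0: "norm (R 0) ^ 2 \<le> (1 / (1 - lam)) ^ (2 * Y)"
      using power_mono[of "norm (R 0)" "(1 / (1 - lam)) ^ Y" 2]
      by (simp add: power_mult[symmetric] mult.commute)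
    have "e * real q \<le> 2 * real q powr -\<sigma> * (4 * real Y) * real q"
      unfolding e_def by (intro mult_right_mono mult_left_mono chebyshev_psi_le) auto
    also have "\<dots> = 8 * real Y * Q" using q8 by (simp add: Q_def powr_diff powr_minus field_simps)
    finally have "e * real q \<le> 8 * real Y * Q" .
    moreover have e0: "e \<ge> 0"
      unfolding e_def chebyshev_psi_def by (intro mult_nonneg_nonneg sum_nonneg mangoldt_nonneg) auto
    ultimately have "norm (of_real e * char_sum 0) \<le> 8 * real Y * Q"
      using mult_left_mono[OF norm_char_sum_le[of 0], of e] by (simp add: norm_mult)
    moreover have "norm (dL_val 0) \<le> X * (Q * (X + 2))"
      unfolding X_def Q_def by (rule norm_dL_val_le)
    ultimately have "norm (m 0) \<le> Q * (X * (X + 2) + 8 * real Y)"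
      using norm_triangle_ineq[of "dL_val 0" "of_real e * char_sum 0"]
      unfolding m_def by (simp add: algebra_simps)
    moreover have "norm (L_val 0) \<le> Q * (X + 2)" unfolding X_def Q_def by (rule norm_L_val_le)
    ultimately have "norm (m 0) * norm (L_val 0) \<le> Q * (X * (X + 2) + 8 * real Y) * (Q * (X + 2))"
      using X0 by (intro mult_mono) (auto simp: Q_def)
    moreover have "Re (m 0 * cnj (L_val 0)) \<le> norm (m 0) * norm (L_val 0)"
      using complex_Re_le_cmod[of "m 0 * cnj (L_val 0)"] by (simp add: norm_mult)
    ultimately have "Re (m 0 * cnj (L_val 0)) \<le> Q * (X * (X + 2) + 8 * real Y) * (Q * (X + 2))"
      by linarith
    hence "norm (R 0) ^ 2 * Re (m 0 * cnj (L_val 0))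
        \<le> norm (R 0) ^ 2 * (Q * (X * (X + 2) + 8 * real Y) * (Q * (X + 2)))"
      by (intro mult_left_mono) auto
    also have "\<dots> \<le> (1 / (1 - lam)) ^ (2 * Y) * (Q * (X * (X + 2) + 8 * real Y) * (Q * (X + 2)))"
      using X0 by (intro mult_right_mono R0) (auto simp: Q_def)
    also have "Q * (X * (X + 2) + 8 * real Y) * (Q * (X + 2))
        = Q * Q * (X + 2) * (X * (X + 2) + 8 * real Y)" by (simp only: mult_ac)
    also have "Q * Q = real q powr (2 * (1 - \<sigma>))"
      unfolding Q_def by (simp only: powr_add[symmetric] mult_2)
    finally show ?thesis by (simp only: mult_ac)
  qed
  finally have main: "mu * (\<Sum>d=1..Y. mangoldt d * real d powr -\<sigma>) * W \<le> Z + V * W"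
    if "Z = (1 / (1 - lam)) ^ (2 * Y) * real q powr (2 * (1 - \<sigma>)) * (X + 2) * (X * (X + 2) + 8 * real Y)" for Z
    unfolding that by simp
  define Z where "Z = (1 / (1 - lam)) ^ (2 * Y) * real q powr (2 * (1 - \<sigma>)) * (X + 2) * (X * (X + 2) + 8 * real Y)"
  have Z0: "Z \<ge> 0"
    unfolding Z_def using lam q8 by (intro mult_nonneg_nonneg add_nonneg_nonneg) (auto simp: X_def)
  have "(mu * (\<Sum>d=1..Y. mangoldt d * real d powr -\<sigma>) - V) * W \<le> Z"
    using main[OF Z_def] by (simp add: algebra_simps)
  hence "mu * (\<Sum>d=1..Y. mangoldt d * real d powr -\<sigma>) - V \<le> Z / W"
    using W N0 by (simp add: pos_le_divide_eq)
  also have "\<dots> \<le> Z / real (q - 1)"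
    using W N0 Z0 by (intro divide_left_mono) auto
  finally show ?thesis by (simp add: Z_def X_def)
qed

end

section \<open>Choice of the parameters\<close>

text \<open>Since \<open>p \<ge> 2\<close>, the exponent is at most \<open>2 * ln x\<close>, and
  Bernoulli's inequality applies. This supplies \<open>mu\<close> for
  \<open>weighted_mangoldt_sum_le\<close>.\<close>

lemma one_minus_power_ge:
  assumes "x \<ge> 2" "prime p" "p ^ k \<le> Y" "real Y \<le> x"
  shows "1 - 2 * ln x / x \<le> (1 - 1 / x) ^ k"
proof -
  have "(2::nat) ^ k \<le> p ^ k" using prime_ge_2_nat[OF assms(2)] by (intro power_mono) auto
  hence "real (2 ^ k) \<le> real Y" using assms(3) by (intro of_nat_mono) linarith
  hence "real (2 ^ k) \<le> x" using assms(4) by linarith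
  hence "2 ^ k \<le> x" by simp
  hence "ln (2 ^ k) \<le> ln x" using assms(1) by (subst ln_le_cancel_iff) auto
  hence "real k * ln 2 \<le> ln x" by (simp add: ln_realpow)
  moreover have "real k * (1 / 2) \<le> real k * ln 2"
    using ln_add1_ge[of "1 :: real"] by (intro mult_left_mono) auto
  ultimately have k: "real k \<le> 2 * ln x" by linarith
  have "1 - 2 * ln x / x \<le> 1 + real k * (- (1 / x))"
    using k assms(1) by (simp add: divide_right_mono)
  also have "\<dots> \<le> (1 + (- (1 / x))) ^ k"
    using assms(1) by (intro Bernoulli_inequality) (auto simp: field_simps)
  finally show ?thesis by simp
qed

text \<open>With \<open>x = ln q\<close> the exponent is \<open>-\<sigma>\<close>. Shrinking the
  cutoff from \<open>x\<close> to \<open>x / ln x ^ 3\<close> lowers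
  \<open>Y powr (A / ln x)\<close> from \<open>exp A\<close> by a relative
  \<open>3 * A * ln (ln x) / ln x\<close> at most; division by \<open>A / ln x\<close> turns this
  into the loss \<open>3 * exp A * ln (ln x)\<close>.\<close>

lemma main_sum_ge:
  fixes A x :: real and Y :: nat
  assumes A: "A > 0" and x: "ln x > 0" "ln (ln x) \<ge> 0" and Y: "real Y \<le> x" "x / ln x ^ 3 \<le> real Y" "Y > 0"
    and small: "2 * ln x / x \<le> 1"
  shows "(1 - 2 * ln x / x) * (\<Sum>d=1..Y. mangoldt d * real d powr (A / ln x - 1))
    \<ge> (exp A - 1) / A * ln x - 3 * exp A * ln (ln x) - 5 * exp A - 2 * ln x / x * (exp A * (ln x + 4))"
proof -
  define \<epsilon> where "\<epsilon> = A / ln x"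
  have \<epsilon>: "\<epsilon> > 0" using A x by (simp add: \<epsilon>_def)
  have x0: "x > 0" using Y by linarith
  have lnY: "ln (real Y) \<le> ln x" using Y x0 by (subst ln_le_cancel_iff) auto
  have Ye: "real Y powr \<epsilon> = exp (\<epsilon> * ln (real Y))" using Y by (simp add: powr_def)
  have le: "real Y powr \<epsilon> \<le> exp A"
  proof -
    have "\<epsilon> * ln (real Y) \<le> \<epsilon> * ln x" using lnY \<epsilon> by (intro mult_left_mono) auto
    also have "\<dots> = A" using x by (simp add: \<epsilon>_def)
    finally show ?thesis by (simp add: Ye)
  qed
  have ge: "real Y powr \<epsilon> \<ge> exp A * (1 - 3 * A * ln (ln x) / ln x)"
  proof -
    have "ln x - 3 * ln (ln x) = ln (x / ln x ^ 3)"
      using x x0 by (simp add: ln_div ln_realpow)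
    also have "\<dots> \<le> ln (real Y)" using Y x x0 by (subst ln_le_cancel_iff) auto
    finally have "\<epsilon> * (ln x - 3 * ln (ln x)) \<le> \<epsilon> * ln (real Y)"
      using \<epsilon> by (intro mult_left_mono) auto
    moreover have "\<epsilon> * (ln x - 3 * ln (ln x)) = A + (- (3 * A * ln (ln x) / ln x))"
      using x by (simp add: \<epsilon>_def field_simps)
    ultimately have "exp A * exp (- (3 * A * ln (ln x) / ln x)) \<le> real Y powr \<epsilon>"
      unfolding Ye exp_add[symmetric] by simp
    moreover have "exp A * (1 + (- (3 * A * ln (ln x) / ln x))) \<le> exp A * exp (- (3 * A * ln (ln x) / ln x))"
      by (intro mult_left_mono exp_ge_add_one_self) auto
    ultimately have "exp A * (1 + (- (3 * A * ln (ln x) / ln x))) \<le> real Y powr \<epsilon>" by linarith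
    thus ?thesis by simp
  qed
  let ?S = "\<Sum>d=1..Y. mangoldt d * real d powr (\<epsilon> - 1)"
  have "(exp A - 1) / A * ln x - 3 * exp A * ln (ln x) = (exp A * (1 - 3 * A * ln (ln x) / ln x) - 1) / \<epsilon>"
    using A x by (simp add: \<epsilon>_def field_simps)
  also have "\<dots> \<le> (real Y powr \<epsilon> - 1) / \<epsilon>"
    using ge \<epsilon> by (intro divide_right_mono) auto
  finally have S1: "(exp A - 1) / A * ln x - 3 * exp A * ln (ln x) - 5 * exp A \<le> ?S"
    using weighted_mertens_ge[OF Y(3) \<epsilon>] le by linarith
  have "?S \<le> real Y powr \<epsilon> * (ln (real Y) + 4)" by (rule weighted_mertens_le[OF Y(3) \<epsilon>])
  also have "\<dots> \<le> exp A * (ln x + 4)" using le lnY Y(3) by (intro mult_mono) auto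
  finally have "2 * ln x / x * ?S \<le> 2 * ln x / x * (exp A * (ln x + 4))"
    using x x0 by (intro mult_left_mono) auto
  hence "(1 - 2 * ln x / x) * ?S \<ge> ?S - 2 * ln x / x * (exp A * (ln x + 4))"
    by (simp add: algebra_simps)
  with S1 show ?thesis unfolding \<epsilon>_def by linarith
qed

text \<open>The cutoff \<open>Y\<close> is \<open>\<lfloor>ln q / (ln (ln q))\<^sup>2\<rfloor>\<close> and the Euler factors are taken at
  \<open>lam = 1 - 1 / ln q\<close>: then \<open>(1 - lam) powr (- 2 Y) = q powr o(1)\<close>, while \<open>Y powr (1 - \<sigma>)\<close>
  still tends to \<open>exp A\<close>.\<close>
lemma exists_large_log_deriv:
  fixes A :: real
  assumes A: "A > 0"
  shows "\<forall>\<^sub>F q::nat in sequentially. prime q \<longrightarrow>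
     (\<exists>\<psi>\<in>nonprincipal_characters q. - Re (log_deriv_L \<psi> (of_real (sigma_A A q)))
       \<ge> (exp A - 1) / A * ln (ln (real q)) - ln (ln (real q)) / ln (ln (ln (real q))))"
proof -
  define V where "V x = (exp A - 1) / A * ln x - ln x / ln (ln x)" for x :: real
  \<comment> \<open>A bound for the principal term with \<open>x = ln q\<close>: the first
    exponential bounds the squared resonator, the second is
    \<open>q powr (2 * (1 - \<sigma>))\<close>.\<close>
  define err where "err x = exp (2 * (x / ln x ^ 2) * ln x) * exp (2 * A / ln x * x) * (x + 2)
            * (x * (x + 2) + 8 * x) / (exp x - 1)" for x :: real
  have eA: "(exp A - 1) / A > 0" using A by simp
  have lim: "filterlim (\<lambda>q. ln (real q)) at_top sequentially" by real_asymp
  have ev: "\<forall>\<^sub>F x in at_top. P (x :: real) \<Longrightarrow> \<forall>\<^sub>F q in sequentially. P (ln (real q))" for P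
    using lim by (rule eventually_compose_filterlim[rotated])
  have 1: "\<forall>\<^sub>F x in at_top. err x \<le> 1"
  proof -
    have "\<forall>\<^sub>F x::real in at_top. c * (x / ln x) \<le> x / 2" if "c > 0" for c
      using that by real_asymp
    from this[of "2 + 2 * A"] have "\<forall>\<^sub>F x::real in at_top. (2 + 2 * A) * (x / ln x) \<le> x / 2"
      using A by simp
    moreover have "\<forall>\<^sub>F x::real in at_top. exp (x / 2) * (x + 2) * (x * (x + 2) + 8 * x) / (exp x - 1) \<le> 1"
      by real_asymp
    moreover have "\<forall>\<^sub>F x::real in at_top. x > 0 \<and> ln x > 0"
      by (intro eventually_conj; real_asymp)
    ultimately show ?thesis
    proof eventually_elim
      case (elim x)
      \<comment> \<open>Both exponents have order \<open>x / ln x\<close>, so together they use at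
        most half of the exponent in the denominator \<open>exp x - 1\<close>.\<close>
      have "2 * (x / ln x ^ 2) * ln x + 2 * A / ln x * x = (2 + 2 * A) * (x / ln x)"
        using elim(3) by (simp add: field_simps power2_eq_square)
      hence "exp (2 * (x / ln x ^ 2) * ln x) * exp (2 * A / ln x * x) \<le> exp (x / 2)"
        unfolding exp_add[symmetric] using elim(1) by simp
      hence "err x \<le> exp (x / 2) * (x + 2) * (x * (x + 2) + 8 * x) / (exp x - 1)"
        unfolding err_def using elim(3) by (intro divide_right_mono mult_right_mono) auto
      thus ?case using elim(2) by linarith
    qed
  qed
  have 2: "\<forall>\<^sub>F x in at_top. V x > 0"
  proof -
    have "\<forall>\<^sub>F x::real in at_top. c * ln x - ln x / ln (ln x) > 0" if "c > 0" for c
      using that by real_asymp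
    from this[OF eA] show ?thesis unfolding V_def .
  qed
  \<comment> \<open>All losses, including the 1 from \<open>err\<close>, are of order
    \<open>ln (ln x)\<close>, which is smaller than the permitted
    \<open>ln x / ln (ln x)\<close>.\<close>
  have 3: "\<forall>\<^sub>F x::real in at_top. ln x / ln (ln x) > 3 * B * ln (ln x) + 5 * B
            + 2 * ln x / x * (B * (ln x + 4)) + 1" if "B > 0" for B
    using that by real_asymp
  \<comment> \<open>The gap of 1 between the two quotients ensures that rounding down keeps
    \<open>Y\<close> above \<open>x / ln x ^ 3\<close>.\<close>
  have 4: "\<forall>\<^sub>F x::real in at_top. x \<ge> 10 \<and> ln x \<ge> 1 \<and> ln (ln x) > 0 \<and> 2 * A / ln x \<le> 1 \<and> 2 * ln x / x \<le> 1
            \<and> x / ln x ^ 3 + 1 \<le> x / ln x ^ 2 \<and> x / ln x ^ 3 > 0"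
    using A by (intro eventually_conj; real_asymp)
  show ?thesis
    using ev[OF 1] ev[OF 2] ev[OF 3[OF exp_gt_zero[of A]]] ev[OF 4]
  proof eventually_elim
    case (elim q)
    define x where "x = ln (real q)"
    define \<sigma> where "\<sigma> = 1 - A / ln x"
    define Y where "Y = nat \<lfloor>x / ln x ^ 2\<rfloor>"
    note h = elim[folded x_def]
    have x10: "x \<ge> 10" and l1: "ln x \<ge> 1" and ll: "ln (ln x) > 0" and Al: "2 * A / ln x \<le> 1"
      and small: "2 * ln x / x \<le> 1" using h(4) by auto
    have q0: "q > 0" using x10 by (intro Nat.gr0I) (simp add: x_def)
    have qx: "real q = exp x" using q0 by (simp add: x_def)
    have x_le_q: "x + 1 \<le> real q" unfolding qx using exp_ge_add_one_self[of x] by linarith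
    have q8: "q \<ge> 8" using x_le_q x10 by linarith
    have "x / ln x ^ 2 \<ge> 0" using x10 by (intro divide_nonneg_nonneg) auto
    hence Yb: "real Y \<le> x / ln x ^ 2" "x / ln x ^ 2 \<le> real Y + 1"
      using of_int_floor_le[of "x / ln x ^ 2"] floor_correct[of "x / ln x ^ 2"]
      by (auto simp: Y_def of_nat_nat)
    have "1 \<le> ln x ^ 2" using l1 by simp
    hence "x / ln x ^ 2 \<le> x / 1" using x10 by (intro divide_left_mono) auto
    hence Yx: "real Y \<le> x" using Yb by simp
    have Yq: "Y < q" using Yx x_le_q by linarith
    have Y3: "x / ln x ^ 3 \<le> real Y" using Yb h(4) by linarith
    have Y0: "Y > 0" using Y3 h(4) by (intro Nat.gr0I) auto
    have \<sigma>: "1 / 2 \<le> \<sigma>" "\<sigma> < 1" using Al A l1 by (simp_all add: \<sigma>_def field_simps)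
    show ?case
    proof (rule impI, rule ccontr)
      assume prime: "prime q" and neg: "\<not> (\<exists>\<psi>\<in>nonprincipal_characters q. - Re (log_deriv_L \<psi> (of_real (sigma_A A q)))
       \<ge> (exp A - 1) / A * ln (ln (real q)) - ln (ln (real q)) / ln (ln (ln (real q))))"
      obtain g where g: "residue_primroot q g" using prime_primitive_root_exists[OF prime_gt_1_nat[OF prime] prime] by blast
      have le: "- Re (log_deriv_L \<psi> (of_real \<sigma>)) \<le> V x" if "\<psi> \<in> nonprincipal_characters q" for \<psi>
      proof -
        have "\<not> - Re (log_deriv_L \<psi> (of_real \<sigma>)) \<ge> V x"
          using neg that unfolding V_def x_def \<sigma>_def sigma_A_def by blast
        thus ?thesis by linarith
      qed
      have lam: "0 \<le> 1 - 1 / x" "1 - 1 / x < 1" using x10 by auto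
      have "(1 - 2 * ln x / x) * (\<Sum>d=1..Y. mangoldt d * real d powr -\<sigma>)
         \<le> V x + (1 / (1 - (1 - 1 / x))) ^ (2 * Y) * real q powr (2 * (1 - \<sigma>)) * (x + 2)
            * (x * (x + 2) + 8 * real Y) / real (q - 1)"
        unfolding x_def
        by (rule weighted_mangoldt_sum_le[OF prime g q8 \<sigma> lam[unfolded x_def] Yq])
           (use h(2) one_minus_power_ge[OF _ _ _ Yx] x10 le in \<open>auto simp: x_def\<close>)
      also have "(1 / (1 - (1 - 1 / x))) ^ (2 * Y) * real q powr (2 * (1 - \<sigma>)) * (x + 2)
            * (x * (x + 2) + 8 * real Y) / real (q - 1) \<le> err x"
      proof -
        have "(1 / (1 - (1 - 1 / x))) ^ (2 * Y) = exp (2 * real Y * ln x)"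
          using x10 powr_realpow[of x "2 * Y"] by (simp add: powr_def)
        also have "\<dots> \<le> exp (2 * (x / ln x ^ 2) * ln x)"
          using Yb l1 unfolding exp_le_cancel_iff by (intro mult_right_mono) auto
        finally have R: "(1 / (1 - (1 - 1 / x))) ^ (2 * Y) \<le> exp (2 * (x / ln x ^ 2) * ln x)" .
        have Q: "real q powr (2 * (1 - \<sigma>)) = exp (2 * A / ln x * x)"
          unfolding qx by (simp add: powr_def \<sigma>_def)
        have N: "real (q - 1) = exp x - 1" using q0 by (simp add: qx of_nat_diff Suc_le_eq)
        show ?thesis unfolding err_def N Q
          using R x10 Yx by (intro divide_right_mono mult_mono mult_nonneg_nonneg add_mono) auto
      qed
      finally have "(1 - 2 * ln x / x) * (\<Sum>d=1..Y. mangoldt d * real d powr (A / ln x - 1)) \<le> V x + 1"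
        using h(1) by (simp add: \<sigma>_def)
      thus False
        using main_sum_ge[OF A _ _ Yx Y3 Y0 small] l1 ll h(3) unfolding V_def by auto
    qed
  qed
qed

theorem theorem3:
  fixes A :: real
  assumes "A > 0"
  shows "\<exists>C>0.
    (\<forall>\<^sub>F q::nat in sequentially. prime q \<longrightarrow>
       Max ((\<lambda>\<psi>. - Re (log_deriv_L \<psi> (of_real (sigma_A A q)))) ` nonprincipal_characters q)
         \<ge> (exp A - 1) / A * ln (ln (real q)) - C * (ln (ln (real q)) / ln (ln (ln (real q))))) \<and>
    (\<forall>\<^sub>F q::nat in sequentially. prime q \<longrightarrow>
       Max ((\<lambda>\<psi>. norm (log_deriv_L \<psi> (of_real (sigma_A A q)))) ` nonprincipal_characters q)
         \<ge> (exp A - 1) / A * ln (ln (real q)) - C * (ln (ln (real q)) / ln (ln (ln (real q)))))"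
proof (intro exI[of _ 1] conjI)
  \<comment> \<open>The witness \<open>C = 1\<close> serves every \<open>A\<close>, because the
    actual loss has the smaller order \<open>ln (ln (ln q))\<close>; the dependence on
    \<open>A\<close> moves into the threshold for \<open>q\<close>.\<close>
  have Max: "y \<le> Max (f ` nonprincipal_characters q)"
    if pr: "prime q" and ex: "\<exists>\<psi>\<in>nonprincipal_characters q. y \<le> f \<psi>" for q y and f :: "(nat \<Rightarrow> complex) \<Rightarrow> real"
  proof -
    obtain \<psi> where \<psi>: "\<psi> \<in> nonprincipal_characters q" "y \<le> f \<psi>" using ex by blast
    have "finite (nonprincipal_characters q)"
      by (rule finite_nonprincipal_characters[OF prime_gt_0_nat[OF pr]])
    hence "f \<psi> \<le> Max (f ` nonprincipal_characters q)" using \<psi>(1) by (intro Max_ge) auto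
    with \<psi>(2) show ?thesis by linarith
  qed
  show "\<forall>\<^sub>F q::nat in sequentially. prime q \<longrightarrow>
       Max ((\<lambda>\<psi>. - Re (log_deriv_L \<psi> (of_real (sigma_A A q)))) ` nonprincipal_characters q)
         \<ge> (exp A - 1) / A * ln (ln (real q)) - 1 * (ln (ln (real q)) / ln (ln (ln (real q))))"
    using exists_large_log_deriv[OF assms]
    by (rule eventually_mono, intro impI Max) simp_all
  show "\<forall>\<^sub>F q::nat in sequentially. prime q \<longrightarrow>
       Max ((\<lambda>\<psi>. norm (log_deriv_L \<psi> (of_real (sigma_A A q)))) ` nonprincipal_characters q)
         \<ge> (exp A - 1) / A * ln (ln (real q)) - 1 * (ln (ln (real q)) / ln (ln (ln (real q))))"
    using exists_large_log_deriv[OF assms]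
  proof (rule eventually_mono, intro impI Max)
    fix q :: nat
    assume "prime q \<longrightarrow> (\<exists>\<psi>\<in>nonprincipal_characters q. - Re (log_deriv_L \<psi> (of_real (sigma_A A q)))
       \<ge> (exp A - 1) / A * ln (ln (real q)) - ln (ln (real q)) / ln (ln (ln (real q))))" "prime q"
    then obtain \<psi> where \<psi>: "\<psi> \<in> nonprincipal_characters q"
      "- Re (log_deriv_L \<psi> (of_real (sigma_A A q)))
         \<ge> (exp A - 1) / A * ln (ln (real q)) - ln (ln (real q)) / ln (ln (ln (real q)))" by blast
    moreover have "- Re (log_deriv_L \<psi> (of_real (sigma_A A q))) \<le> norm (log_deriv_L \<psi> (of_real (sigma_A A q)))"
      using complex_Re_le_cmod[of "- log_deriv_L \<psi> (of_real (sigma_A A q))"] by simp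
    ultimately show "\<exists>\<psi>\<in>nonprincipal_characters q. (exp A - 1) / A * ln (ln (real q))
        - 1 * (ln (ln (real q)) / ln (ln (ln (real q)))) \<le> norm (log_deriv_L \<psi> (of_real (sigma_A A q)))"
      by (intro bexI[of _ \<psi>]) linarith+
  qed
qed simp

end
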